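(* Let $\gamma$ be a simple curve in the upper half-plane $\mathbb{H}$ that lands at $-1$ and $1$, so that $\gamma$ together with the interval $[-1,1]$ bounds a simply-connected domain $B\subset\mathbb{H}$. Suppose that there exists a conformal reflection $f$ across $\gamma$ (defined on $B$) that maps $B$ inside $\mathbb{H}$. Then $\gamma$ is a real-analytic curve of Euclidean length at most $\pi$, with equality if and only if $\gamma$ is a semicircle on the diameter $[-1,1]$.
   Context: $\mathbb{H}$ is the open upper half-plane in $\mathbb{C}$. Definition (conformal reflection). Let $V$ be a domain in $\mathbb{C}$ bounded by a Jordan curve, and let $\gamma$ be an arc of that boundary. A map $f:V\to\mathbb{C}\setminus\overline{V}$ is a conformal reflection across $\gamma$ if $f$ is an anti-analytic injection and the map $\tilde f$ given by \[\tilde f(z)=\begin{cases} f(z) & \text{if } z\in V,\\ z & \text{if } z\in\gamma,\\ f^{-1}(z) & \text{if } z\in f(V)\end{cases}\] defines an anti-conformal automorphism (an anti-holomorphic bijection onto itself) of the domain $V\cup\gamma\cup f(V)$. In the claim this is applied with $V=B$, $\gamma$ being regarded as an open arc (without its endpoints $\pm1$). *)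

theory Defs
  imports "HOL-Complex_Analysis.Complex_Analysis"
begin

definition upper_half_plane :: "complex set" where
  "upper_half_plane = {z. Im z > 0}"

definition anti_holomorphic_on :: "(complex \<Rightarrow> complex) \<Rightarrow> complex set \<Rightarrow> bool"
    (infixl \<open>anti'_holomorphic'_on\<close> 50) where
  "f anti_holomorphic_on S \<longleftrightarrow> (\<lambda>z. cnj (f z)) holomorphic_on S"

definition domain :: "complex set \<Rightarrow> bool" where
  "domain U \<longleftrightarrow> U \<noteq> {} \<and> open U \<and> connected U"

definition anti_conformal_automorphism :: "(complex \<Rightarrow> complex) \<Rightarrow> complex set \<Rightarrow> bool" where
  "anti_conformal_automorphism F U \<longleftrightarrow>
     domain U \<and> F anti_holomorphic_on U \<and> bij_betw F U U"

definition open_arc :: "(real \<Rightarrow> 'a::topological_space) \<Rightarrow> 'a set" where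
  "open_arc g = g ` {0<..<1}"

definition bounded_by_jordan_curve :: "complex set \<Rightarrow> bool" where
  "bounded_by_jordan_curve V \<longleftrightarrow>
     (\<exists>p. simple_path p \<and> pathfinish p = pathstart p \<and> V = inside (path_image p))"

definition reflection_extension ::
    "(complex \<Rightarrow> complex) \<Rightarrow> complex set \<Rightarrow> complex set \<Rightarrow> complex \<Rightarrow> complex" where
  "reflection_extension f V \<gamma> z =
     (if z \<in> V then f z else if z \<in> \<gamma> then z else the_inv_into V f z)"

definition conformal_reflection ::
    "(complex \<Rightarrow> complex) \<Rightarrow> complex set \<Rightarrow> complex set \<Rightarrow> bool" where
  "conformal_reflection f V \<gamma> \<longleftrightarrow>
     bounded_by_jordan_curve V \<and>
     (\<exists>g. arc g \<and> path_image g \<subseteq> frontier V \<and> \<gamma> = open_arc g) \<and>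
     f ` V \<subseteq> - closure V \<and>
     f anti_holomorphic_on V \<and> inj_on f V \<and>
     anti_conformal_automorphism (reflection_extension f V \<gamma>) (V \<union> \<gamma> \<union> f ` V)"

definition real_analytic_on ::
    "(real \<Rightarrow> 'a::real_normed_vector) \<Rightarrow> real set \<Rightarrow> bool"
    (infixl \<open>real'_analytic'_on\<close> 50) where
  "c real_analytic_on T \<longleftrightarrow>
     (\<forall>t\<in>T. \<exists>r>0. \<exists>a. \<forall>s. \<bar>s - t\<bar> < r \<longrightarrow> (\<lambda>n. (s - t) ^ n *\<^sub>R a n) sums c s)"

text \<open>The nonvanishing derivative matters: without it, curves with cusps would be admitted.\<close>

definition real_analytic_curve :: "'a::real_normed_vector set \<Rightarrow> bool" where
  "real_analytic_curve \<Gamma> \<longleftrightarrow>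
     (\<exists>c. c real_analytic_on {0<..<1} \<and>
          (\<forall>t\<in>{0<..<1}. vector_derivative c (at t) \<noteq> 0) \<and>
          inj_on c {0<..<1} \<and> \<Gamma> = c ` {0<..<1})"

text \<open>Supremum of the lengths of inscribed polygons. A partition is a sorted list of
  parameters; lists that do not start at 0 or end at 1, or that have repetitions, do not
  change the supremum.\<close>

definition curve_length :: "(real \<Rightarrow> 'a::metric_space) \<Rightarrow> ennreal" where
  "curve_length g =
     (SUP ts \<in> {ts. sorted ts \<and> set ts \<subseteq> {0..1}}.
        \<Sum>i<length ts - 1. ennreal (dist (g (ts ! i)) (g (ts ! Suc i))))"

end

theory Submission
  imports Defs
begin

text \<open>
  Let \<open>F\<close> be the extended reflection and \<open>U = B \<union> \<gamma> \<union> f ` B\<close> its domain, which is contained in the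
  upper half-plane. The idea is that \<open>\<gamma>\<close> is a hyperbolic geodesic of \<open>U\<close>, while the hyperbolic
  metric of \<open>U\<close> is at least that of the half-plane, and that the Euclidean length of \<open>\<gamma>\<close> can be
  computed from this comparison.

  The domain \<open>U\<close> is simply connected (\<open>simply_connected_reflected_union\<close>), so there is a conformal
  map \<open>Q\<close> of the half-plane onto \<open>U\<close>, and it can be normalised so that \<open>F\<close> corresponds to the
  reflection in the imaginary axis (\<open>reflection_uniformization\<close>). Then \<open>\<gamma>\<close>, the fixed set of \<open>F\<close>,
  is the image of the imaginary axis, which makes it real-analytic, and \<open>B\<close> is the image of the
  first quadrant. Parametrise \<open>\<gamma>\<close> by \<open>x \<mapsto> Q (\<i> * exp x)\<close>. Since \<open>Q\<close> maps the half-plane into itself,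
  the Schwarz-Pick inequality bounds the speed of this parametrisation by \<open>Im Q (\<i> * exp x)\<close>.

  The integral of this bound over the whole line is exactly \<open>pi\<close>, of which only \<open>\<le>\<close> is needed.
  Put \<open>\<phi> z = Q (exp z)\<close> and apply Cauchy's theorem to a rectangle with horizontal sides at heights 0 and
  \<open>pi / 2\<close>. The function \<open>\<phi>\<close> is real on the lower side, because boundary values of \<open>Q\<close> at the positive
  real axis lie in the closure of \<open>B\<close> but not in \<open>U\<close>, hence in the real segment. On the vertical
  sides \<open>\<phi>\<close> tends to 1 and -1, the end points of \<open>\<gamma>\<close>. So the imaginary part of the integral over the
  upper side tends to the difference 2 times the height \<open>pi / 2\<close>. This is
  \<open>half_plane_height_primitive\<close>.

  If the length is \<open>pi\<close>, equality must hold in the Schwarz-Pick inequality at every point of the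
  imaginary axis (\<open>imaginary_axis_dist_le_strict\<close>). Then \<open>Q\<close> is a Moebius map, and \<open>\<gamma>\<close> is the
  geodesic of the half-plane from -1 to 1 (\<open>Schwarz_Pick_extremal_unit_circle\<close>). Conversely, inscribed
  regular polygons show that the semicircle has length at least \<open>pi\<close>.
\<close>

section \<open>Simple connectedness of the reflected domain\<close>

lemma inside_connected_subset:
  assumes "connected C" "C \<inter> inside S \<noteq> {}" "C \<inter> S = {}" "frontier (inside S) \<subseteq> S"
  shows "C \<subseteq> inside S"
  using connected_Int_frontier[of C "inside S"] assms by blast

text \<open>
  Points of the interior that are close to \<open>p\<close> can be joined inside it without going far from
  \<open>p\<close>. Let \<open>A\<close> be the curve without an open subarc around \<open>p\<close> so short that it lies in the
  disc of radius \<open>r\<close>. Two interior points near \<open>p\<close> are not separated by the curve,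
  and not by \<open>A\<close> together with the exterior of the disc of radius \<open>r\<close>. The intersection of these two closed sets is the connected set \<open>A\<close>, so by Janiszewski
  their union does not separate the points either. The base point is excluded because it sits at
  both ends of the parameter interval, where the short subarc would have two parameter pieces.
\<close>
lemma jordan_interior_locally_connected_at_boundary:
  fixes c :: "real \<Rightarrow> complex"
  assumes c: "simple_path c" "pathfinish c = pathstart c"
    and p: "p \<in> path_image c" "p \<noteq> pathstart c" and r: "0 < r"
  obtains s where "0 < s" "s \<le> r"
    "\<And>a b. a \<in> inside (path_image c) \<inter> ball p s \<Longrightarrow> b \<in> inside (path_image c) \<inter> ball p s \<Longrightarrow>
       \<exists>C. connected C \<and> a \<in> C \<and> b \<in> C \<and> C \<subseteq> inside (path_image c) \<inter> ball p r"
proof -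
  let ?J = "path_image c"
  have cont: "continuous_on {0..1} c" 
    using c(1) simple_path_imp_path path_def by blast
  obtain t where t: "t \<in> {0..1}" "p = c t" using p(1) by (auto simp: path_image_def)
  then have t01: "0 < t" "t < 1"
    using p(2) c(2) by (auto simp: pathstart_def pathfinish_def order_le_less)
  from cont t r obtain d where d: "d > 0" "\<And>u. u \<in> {0..1} \<Longrightarrow> \<bar>u - t\<bar> < d \<Longrightarrow> dist (c u) p < r"
    unfolding continuous_on_iff dist_real_def by blast
  define \<eta> where "\<eta> = Min {d/2, t/2, (1-t)/2}"
  have eta: "0 < \<eta>" "\<eta> < d" "\<eta> < t" "\<eta> < 1 - t"
    using d(1) t01 by (auto simp: \<eta>_def min_less_iff_disj)
  define A where "A = c ` {0..t-\<eta>} \<union> c ` {t+\<eta>..1}"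
  have comp: "compact A" unfolding A_def using eta t01
    by (intro compact_Un compact_continuous_image continuous_on_subset[OF cont]) auto
  have conA: "connected A" unfolding A_def
  proof (rule connected_Un)
    have "c 0 = c 1" using c(2) by (simp add: pathstart_def pathfinish_def)
    moreover have "0 \<in> {0..t-\<eta>}" "1 \<in> {t+\<eta>..1}" using eta t01 by auto
    then have "c 0 \<in> c ` {0..t-\<eta>}" "c 1 \<in> c ` {t+\<eta>..1}" by (simp_all only: imageI)
    ultimately have "c 0 \<in> c ` {0..t-\<eta>} \<inter> c ` {t+\<eta>..1}" by simp
    then show "c ` {0..t-\<eta>} \<inter> c ` {t+\<eta>..1} \<noteq> {}" by blast
    show "connected (c ` {0..t-\<eta>})" "connected (c ` {t+\<eta>..1})"
      by (rule connected_continuous_image, rule continuous_on_subset[OF cont]; use eta t01 in force)+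
  qed
  have AJ: "A \<subseteq> ?J" using eta t01 by (auto simp: A_def path_image_def)
  have pA: "p \<notin> A"
  proof
    assume "p \<in> A"
    then obtain u where u: "u \<in> {0..t-\<eta>} \<union> {t+\<eta>..1}" "c u = c t"
      using t(2) unfolding A_def image_Un[symmetric] by (metis imageE)
    then have "u \<in> {0..1}" "u \<noteq> t" using eta t01 by auto
    moreover have "u = t \<or> u = 0 \<and> t = 1 \<or> u = 1 \<and> t = 0"
      using c(1) u(2) t(1) calculation(1) unfolding simple_path_def loop_free_def by blast
    ultimately show False using t01 by simp
  qed
  have "open (- A)" using comp compact_imp_closed by blast
  with pA obtain s0 where s0: "s0 > 0" "ball p s0 \<subseteq> - A"
    by (meson ComplI open_contains_ball)
  define s where "s = min s0 r"
  have s: "0 < s" "s \<le> r" "ball p s \<inter> A = {}" using s0 r by (auto simp: s_def)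
  have fr: "frontier (inside ?J) = ?J" using Jordan_inside_outside[OF c] by blast
  have "\<exists>C. connected C \<and> a \<in> C \<and> b \<in> C \<and> C \<subseteq> inside ?J \<inter> ball p r"
    if a: "a \<in> inside ?J \<inter> ball p s" and b: "b \<in> inside ?J \<inter> ball p s" for a b
  proof -
    define T where "T = A \<union> - ball p r"
    have "c u \<in> A" if "u \<in> {0..1}" "c u \<notin> ball p r" for u
    proof -
      have "\<not> \<bar>u - t\<bar> < d" using d(2) that by (auto simp: dist_commute)
      then have "u \<in> {0..t-\<eta>} \<union> {t+\<eta>..1}" using that(1) eta by auto
      then show ?thesis by (auto simp: A_def)
    qed
    then have JT: "?J \<inter> T = A" using AJ by (auto simp: T_def path_image_def)
    have "connected_component (- (?J \<union> T)) a b"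
    proof (rule Janiszewski)
      show "compact ?J" using c(1) by (simp add: compact_simple_path_image)
      show "closed T" unfolding T_def
        by (intro closed_Un compact_imp_closed[OF comp] closed_Compl open_ball)
      show "connected (?J \<inter> T)" using JT conA by simp
      have "connected (inside ?J)" using Jordan_inside_outside[OF c] by blast
      moreover have "inside ?J \<subseteq> - ?J" by (simp add: inside_def subset_iff)
      ultimately show "connected_component (- ?J) a b"
        using a b unfolding connected_component_def by blast
      have "ball p s \<subseteq> - T" using s by (auto simp: T_def)
      then show "connected_component (- T) a b"
        using a b convex_connected[OF convex_ball] unfolding connected_component_def by blast
    qed
    then obtain C where C: "connected C" "C \<subseteq> - (?J \<union> T)" "a \<in> C" "b \<in> C"
      unfolding connected_component_def by blast
    moreover have "C \<subseteq> inside ?J" using inside_connected_subset[of C ?J] C a fr by blast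
    ultimately show ?thesis by (auto simp: T_def)
  qed
  with s that show thesis by blast
qed

text \<open>
  A continuous logarithm on \<open>S\<close> extends to boundary points at which \<open>S\<close> is locally connected:
  near such a point \<open>p\<close> the function has the logarithm \<open>Ln (u z / u p)\<close>, and on the piece of
  \<open>S\<close> near \<open>p\<close> the two logarithms differ by a constant \<open>k p\<close>, since their difference is
  continuous with values in a discrete set. As \<open>Ln 1 = 0\<close>, this constant is the value of the
  extension at \<open>p\<close>.
\<close>
lemma Borsukian_between_closure:
  fixes S X :: "complex set"
  assumes S: "Borsukian S" and SX: "S \<subseteq> X" "X \<subseteq> closure S"
    and loc: "\<And>p r. p \<in> X \<Longrightarrow> 0 < r \<Longrightarrow> \<exists>s>0. s \<le> r \<and>
       (\<forall>a\<in>S \<inter> ball p s. \<forall>b\<in>S \<inter> ball p s. \<exists>C. connected C \<and> a \<in> C \<and> b \<in> C \<and> C \<subseteq> S \<inter> ball p r)"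
  shows "Borsukian X"
  unfolding Borsukian_continuous_logarithm
proof (intro allI impI, elim conjE)
  fix u :: "complex \<Rightarrow> complex" assume u: "continuous_on X u" "u \<in> X \<rightarrow> - {0}"
  have nz: "u z \<noteq> 0" if "z \<in> X" for z using u(2) that by auto
  obtain l where l: "continuous_on S l" "\<And>z. z \<in> S \<Longrightarrow> u z = exp (l z)"
  proof -
    have "continuous_on S u \<and> u \<in> S \<rightarrow> - {0}" using u SX continuous_on_subset by auto
    then show thesis using S that unfolding Borsukian_continuous_logarithm by metis
  qed
  have "\<exists>k s. 0 < s \<and> continuous_on (X \<inter> ball p s) (\<lambda>z. Ln (u z / u p)) \<and>
     (\<forall>z\<in>S \<inter> ball p s. l z = k + Ln (u z / u p))" if p: "p \<in> X" for p
  proof -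
    have "0 < norm (u p)" using nz p by simp
    then obtain r where r: "r > 0" "\<And>z. z \<in> X \<Longrightarrow> dist z p < r \<Longrightarrow> dist (u z) (u p) < norm (u p)"
      using u(1) p unfolding continuous_on_iff by metis
    have Re: "0 < Re (u z / u p)" if "z \<in> X \<inter> ball p r" for z
    proof -
      have "norm (u z - u p) < norm (u p)" using r(2)[of z] that by (simp add: dist_commute flip: dist_norm)
      moreover have "u z / u p - 1 = (u z - u p) / u p" using nz[OF p] by (simp add: diff_divide_distrib)
      ultimately have "norm (u z / u p - 1) < 1"
        using nz[OF p] by (simp add: norm_divide)
      moreover have "\<bar>Re (u z / u p - 1)\<bar> \<le> norm (u z / u p - 1)" by (rule abs_Re_le_cmod)
      ultimately show ?thesis by (simp add: abs_if split: if_splits)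
    qed
    have cL: "continuous_on (X \<inter> ball p r) (\<lambda>z. Ln (u z / u p))"
    proof (intro continuous_on_Ln' continuous_on_divide continuous_on_const continuous_on_subset[OF u(1)])
      fix z assume "z \<in> X \<inter> ball p r"
      then show "u z / u p \<notin> \<real>\<^sub>\<le>\<^sub>0" using Re[of z] unfolding complex_nonpos_Reals_iff by linarith
    qed (use nz[OF p] in auto)
    obtain s where s: "s > 0" "s \<le> r" 
      "\<And>a b. a \<in> S \<inter> ball p s \<Longrightarrow> b \<in> S \<inter> ball p s \<Longrightarrow> \<exists>C. connected C \<and> a \<in> C \<and> b \<in> C \<and> C \<subseteq> S \<inter> ball p r"
      using loc[OF p r(1)] by blast
    have "p \<in> closure S" using p SX by auto
    then obtain a where a: "a \<in> S \<inter> ball p s"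
      using s(1) unfolding closure_approachable by (force simp: dist_commute)
    define k where "k = l a - Ln (u a / u p)"
    have "l z = k + Ln (u z / u p)" if z: "z \<in> S \<inter> ball p s" for z
    proof -
      obtain C where C: "connected C" "a \<in> C" "z \<in> C" "C \<subseteq> S \<inter> ball p r" using s(3) a z by blast
      let ?h = "\<lambda>z. l z - Ln (u z / u p)"
      have eh: "exp (?h w) = u p" if "w \<in> C" for w
      proof -
        have "w \<in> S" "w \<in> X" using that C SX by auto
        then show ?thesis using l(2)[of w] nz p by (simp add: exp_diff)
      qed
      have "?h constant_on C"
      proof (rule continuous_discrete_range_constant[OF C(1)])
        show "continuous_on C ?h"
          by (intro continuous_intros continuous_on_subset[OF l(1)] continuous_on_subset[OF cL])
             (use C SX in auto)
        show "\<exists>e>0. \<forall>y. y \<in> C \<and> ?h y \<noteq> ?h x \<longrightarrow> e \<le> norm (?h y - ?h x)" if "x \<in> C" for x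
        proof (intro exI[of _ 1] conjI allI impI)
          fix y assume y: "y \<in> C \<and> ?h y \<noteq> ?h x"
          then have "exp (?h y) = exp (?h x)" using eh that by simp
          moreover have "\<bar>Im (?h y) - Im (?h x)\<bar> < 2 * pi" if "norm (?h y - ?h x) < 1"
            using abs_Im_le_cmod[of "?h y - ?h x"] that pi_gt3 unfolding minus_complex.sel(2) by linarith
          ultimately show "1 \<le> norm (?h y - ?h x)"
            using y exp_complex_eqI[of "?h y" "?h x"] by (meson not_le)
        qed auto
      qed
      then have "?h z = ?h a" using C unfolding constant_on_def by metis
      then show ?thesis by (simp add: k_def algebra_simps)
    qed
    moreover have "continuous_on (X \<inter> ball p s) (\<lambda>z. Ln (u z / u p))"
      by (rule continuous_on_subset[OF cL]) (use s in auto)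
    ultimately show ?thesis using s(1) by blast
  qed
  then have "\<forall>p\<in>X. \<exists>k s. 0 < s \<and> continuous_on (X \<inter> ball p s) (\<lambda>z. Ln (u z / u p)) \<and>
     (\<forall>z\<in>S \<inter> ball p s. l z = k + Ln (u z / u p))" by blast
  from this[unfolded bchoice_iff] obtain k where "\<forall>p\<in>X. \<exists>s. 0 < s \<and> continuous_on (X \<inter> ball p s) (\<lambda>z. Ln (u z / u p)) \<and>
     (\<forall>z\<in>S \<inter> ball p s. l z = k p + Ln (u z / u p))" by blast
  from this[unfolded bchoice_iff] obtain s where ks: "\<And>p. p \<in> X \<Longrightarrow> 0 < s p"
      "\<And>p. p \<in> X \<Longrightarrow> continuous_on (X \<inter> ball p (s p)) (\<lambda>z. Ln (u z / u p))"
      "\<And>p z. p \<in> X \<Longrightarrow> z \<in> S \<inter> ball p (s p) \<Longrightarrow> l z = k p + Ln (u z / u p)"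
    by blast
  have ek: "u p = exp (k p)" if p: "p \<in> X" for p
  proof -
    have "p \<in> closure S" using p SX by auto
    then obtain a where a: "a \<in> S \<inter> ball p (s p)"
      using ks(1)[OF p] unfolding closure_approachable by (force simp: dist_commute)
    then have aX: "a \<in> X" using SX by auto
    have "u a = exp (k p) * (u a / u p)"
      using ks(3)[OF p a] l(2)[of a] a nz[OF aX] nz[OF p] by (simp add: exp_add)
    then show ?thesis using nz[OF aX] nz[OF p] by (simp add: field_simps)
  qed
  have kq: "k q = k p + Ln (u q / u p)" if p: "p \<in> X" and q: "q \<in> X \<inter> ball p (s p)" for p q
  proof -
    have qX: "q \<in> X" using q by auto
    define N where "N = ball p (s p) \<inter> ball q (s q)"
    have "open N" "q \<in> N" using q ks(1)[OF qX] by (auto simp: N_def)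
    have eq: "k q + Ln (u z / u q) - (k p + Ln (u z / u p)) = 0" if "z \<in> S \<inter> N" for z
      using ks(3)[OF p, of z] ks(3)[OF qX, of z] that by (auto simp: N_def)
    have cl: "q \<in> closure (S \<inter> N)"
      using \<open>open N\<close> \<open>q \<in> N\<close> qX SX open_Int_closure_subset[of N S] by (auto simp: Int_commute)
    let ?h = "\<lambda>z. k q + Ln (u z / u q) - (k p + Ln (u z / u p))"
    have "continuous_on (X \<inter> N) ?h"
      by (intro continuous_intros continuous_on_subset[OF ks(2)[OF p]] continuous_on_subset[OF ks(2)[OF qX]])
         (auto simp: N_def)
    then have ch: "continuous_on (insert q (S \<inter> N)) ?h"
      by (rule continuous_on_subset) (use \<open>q \<in> N\<close> qX SX in auto)
    have "?h q = 0"
    proof (rule ccontr)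
      assume "?h q \<noteq> 0"
      then obtain d where "d > 0" "\<And>z. z \<in> insert q (S \<inter> N) \<Longrightarrow> dist z q < d \<Longrightarrow> dist (?h z) (?h q) < norm (?h q)"
        using ch unfolding continuous_on_iff by (metis insertI1 zero_less_norm_iff)
      moreover obtain z where "z \<in> S \<inter> N" "dist z q < d" 
        using cl \<open>d > 0\<close> unfolding closure_approachable by blast
      ultimately show False using eq[of z] by (metis dist_0_norm insertCI less_irrefl)
    qed
    then show ?thesis using nz[OF qX] by simp
  qed
  have "continuous_on X k"
    unfolding continuous_on_eq_continuous_within
  proof
    fix p assume p: "p \<in> X"
    have "continuous_on (X \<inter> ball p (s p)) (\<lambda>q. k p + Ln (u q / u p))"
      by (intro continuous_intros ks(2)[OF p])
    then have "continuous_on (X \<inter> ball p (s p)) k"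
      by (rule continuous_on_eq) (use kq[OF p] in auto)
    then have "continuous (at p within X \<inter> ball p (s p)) k"
      using p ks(1)[OF p] by (simp add: continuous_on_eq_continuous_within)
    then show "continuous (at p within X) k"
      using at_within_nhd[of p "ball p (s p)" "X \<inter> ball p (s p)" X] ks(1)[OF p]
      by (simp add: continuous_within inf_assoc)
  qed
  then show "\<exists>g. continuous_on X g \<and> (\<forall>x\<in>X. u x = exp (g x))" using ek by blast
qed


text \<open>
  Glues the Jordan domain to its mirror image. The two halves \<open>B \<union> \<gamma>\<close> and
  \<open>F ` B \<union> \<gamma>\<close> are relatively closed in \<open>U\<close>, are homeomorphic through \<open>F\<close>, and meet in the
  connected set \<open>\<gamma>\<close>; hence continuous logarithms on the halves fit together. For open
  plane sets the existence of logarithms is equivalent to simple connectedness.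
\<close>
lemma simply_connected_reflected_union:
  fixes c :: "real \<Rightarrow> complex"
  assumes c: "simple_path c" "pathfinish c = pathstart c"
    and B: "B = inside (path_image c)"
    and \<gamma>: "\<gamma> \<subseteq> path_image c - {pathstart c}" "connected \<gamma>"
    and U: "open U" "connected U" "U = B \<union> \<gamma> \<union> F ` B"
    and F: "continuous_on U F" "\<And>z. z \<in> U \<Longrightarrow> F z \<in> U \<and> F (F z) = z" "\<And>z. z \<in> \<gamma> \<Longrightarrow> F z = z"
    and FB: "F ` B \<inter> closure B = {}"
  shows "simply_connected U"
proof -
  have J: "open B" "frontier B = path_image c"
    using Jordan_inside_outside[OF c] B by auto
  have "closure B = B \<union> path_image c"
    using closure_Un_frontier[of B] J by simp
  then have cl: "B \<union> \<gamma> \<subseteq> closure B" using \<gamma> by auto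
  have B\<gamma>: "Borsukian (B \<union> \<gamma>)"
  proof (rule Borsukian_between_closure)
    show "Borsukian B"
      using simply_connected_inside_simple_path[OF c(1)] J(1) simply_connected_eq_Borsukian B by blast
    fix p and r :: real assume p: "p \<in> B \<union> \<gamma>" and r: "0 < r"
    show "\<exists>s>0. s \<le> r \<and> (\<forall>a\<in>B \<inter> ball p s. \<forall>b\<in>B \<inter> ball p s.
            \<exists>C. connected C \<and> a \<in> C \<and> b \<in> C \<and> C \<subseteq> B \<inter> ball p r)"
    proof (cases "p \<in> B")
      case True
      then obtain s0 where s0: "s0 > 0" "ball p s0 \<subseteq> B" using J(1) open_contains_ball by blast
      define s where "s = min s0 r"
      have s: "0 < s" "s \<le> r" "ball p s \<subseteq> B \<inter> ball p r" using s0 r by (auto simp: s_def)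
      show ?thesis
        by (intro exI[of _ s] conjI s ballI exI[of _ "ball p s"] convex_connected convex_ball) (use s in auto)
    next
      case False
      then have "p \<in> path_image c" "p \<noteq> pathstart c" using p \<gamma> by auto
      from jordan_interior_locally_connected_at_boundary[OF c this r]
      show ?thesis unfolding B by (metis (no_types, lifting))
    qed
  qed (use cl in auto)
  have FF: "F ` (F ` B) = B" using F(2) U(3) by (force simp: image_iff)
  have "homeomorphism (B \<union> \<gamma>) (F ` B \<union> \<gamma>) F F"
  proof (rule homeomorphismI)
    show "continuous_on (B \<union> \<gamma>) F" "continuous_on (F ` B \<union> \<gamma>) F"
      using F(1) U(3) by (auto intro: continuous_on_subset)
    show "F ` (B \<union> \<gamma>) \<subseteq> F ` B \<union> \<gamma>" using F(3) by auto
    show "F ` (F ` B \<union> \<gamma>) \<subseteq> B \<union> \<gamma>" using F(3) FF by auto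
  qed (use F(2) U(3) in auto)
  then have FB\<gamma>: "Borsukian (F ` B \<union> \<gamma>)"
    using B\<gamma> homeomorphic_Borsukian_eq homeomorphic_def by blast
  have UU: "(B \<union> \<gamma>) \<union> (F ` B \<union> \<gamma>) = U" using U by auto
  have dis: "B \<inter> \<gamma> = {}" using \<gamma> B by (auto simp: inside_def)
  have "Borsukian ((B \<union> \<gamma>) \<union> (F ` B \<union> \<gamma>))"
  proof (rule Borsukian_closed_Un[OF _ _ B\<gamma> FB\<gamma>], unfold UU)
    have "B \<union> \<gamma> = U \<inter> closure B" using cl FB U by auto
    then show "closedin (top_of_set U) (B \<union> \<gamma>)" by (simp add: closedin_closed_Int)
    have "F ` B \<union> \<gamma> = U \<inter> - B" using FB U dis closure_subset[of B] by auto
    then show "closedin (top_of_set U) (F ` B \<union> \<gamma>)"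
      using closedin_closed_Int[OF closed_Compl[OF J(1)], of U] by simp
    have "(B \<union> \<gamma>) \<inter> (F ` B \<union> \<gamma>) = \<gamma>" using FB dis closure_subset[of B] by auto
    then show "connected ((B \<union> \<gamma>) \<inter> (F ` B \<union> \<gamma>))" using \<gamma> by simp
  qed
  then show ?thesis using U UU simply_connected_eq_Borsukian by metis
qed

section \<open>The Schwarz-Pick lemma in the upper half-plane\<close>

lemma holomorphic_on_compose_fun:
  assumes "f holomorphic_on A" "g holomorphic_on B" "\<And>z. z \<in> A \<Longrightarrow> f z \<in> B"
  shows "(\<lambda>z. g (f z)) holomorphic_on A"
  using holomorphic_on_compose_gen[of f A g B] assms by (auto simp: o_def)

lemma half_plane_dist_less:
  assumes "a \<in> upper_half_plane" "z \<in> upper_half_plane"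
  shows "cmod (z - a) < cmod (z - cnj a)"
proof -
  have "cmod (z - cnj a) ^ 2 - cmod (z - a) ^ 2 = 4 * (Im z * Im a)"
    unfolding cmod_power2 by (simp add: power2_eq_square algebra_simps)
  moreover have "0 < Im z * Im a" using assms by (simp add: upper_half_plane_def)
  ultimately show ?thesis by (intro power_less_imp_less_base[OF _ norm_ge_zero, of _ 2]) linarith
qed

text \<open>
  The Cayley transform of the upper half-plane that sends \<open>a\<close> to 0. Its modulus at \<open>z\<close> is the
  pseudo-hyperbolic distance of \<open>a\<close> and \<open>z\<close>.
\<close>
definition cayley :: "complex \<Rightarrow> complex \<Rightarrow> complex" where
  "cayley a z = (z - a) / (z - cnj a)"

definition inv_cayley :: "complex \<Rightarrow> complex \<Rightarrow> complex" where
  "inv_cayley a w = (a - cnj a * w) / (1 - w)"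

lemma half_plane_neq_cnj:
  "a \<in> upper_half_plane \<Longrightarrow> z \<in> upper_half_plane \<Longrightarrow> z \<noteq> cnj a"
  by (auto simp: upper_half_plane_def)

lemma cayley_in_ball:
  assumes "a \<in> upper_half_plane" "z \<in> upper_half_plane"
  shows "cayley a z \<in> ball 0 1"
  using half_plane_dist_less[OF assms] half_plane_neq_cnj[OF assms]
  by (simp add: cayley_def norm_divide)

lemma inv_cayley_cayley:
  assumes "a \<in> upper_half_plane" "z \<in> upper_half_plane"
  shows "inv_cayley a (cayley a z) = z"
proof -
  have "z - cnj a \<noteq> 0" using half_plane_neq_cnj[OF assms] by simp
  moreover have "a \<noteq> cnj a" using half_plane_neq_cnj[OF assms(1,1)] .
  ultimately show ?thesis
    by (simp add: inv_cayley_def cayley_def divide_simps) (simp add: algebra_simps)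
qed

lemma inv_cayley_in_half_plane:
  assumes a: "a \<in> upper_half_plane" and w: "w \<in> ball 0 1"
  shows "inv_cayley a w \<in> upper_half_plane"
proof (rule ccontr)
  define z where "z = inv_cayley a w"
  have w1: "w \<noteq> 1" using w by auto
  then have eq: "z - a = w * (z - cnj a)"
    by (simp add: z_def inv_cayley_def divide_simps) (simp add: algebra_simps)
  assume "inv_cayley a w \<notin> upper_half_plane"
  then have "Im z * Im a \<le> 0"
    using a by (simp add: upper_half_plane_def z_def mult_nonpos_nonneg)
  moreover have "cmod (z - cnj a) ^ 2 - cmod (z - a) ^ 2 = 4 * (Im z * Im a)"
    unfolding cmod_power2 by (simp add: power2_eq_square algebra_simps)
  ultimately have "cmod (z - cnj a) \<le> cmod (z - a)"
    by (intro power2_le_imp_le[OF _ norm_ge_zero]) linarith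
  also have "\<dots> = cmod w * cmod (z - cnj a)" by (simp add: eq norm_mult)
  finally have "z - cnj a = 0"
    using w by (cases "z - cnj a = 0") (auto simp: field_simps)
  with eq have "cnj a = a" by simp
  then show False using half_plane_neq_cnj[OF a a] by simp
qed

lemma cayley_inv_cayley:
  assumes a: "a \<in> upper_half_plane" and w: "w \<in> ball 0 1"
  shows "cayley a (inv_cayley a w) = w"
proof -
  have w1: "1 - w \<noteq> 0" using w by auto
  have "a \<noteq> cnj a" using half_plane_neq_cnj[OF a a] .
  with w1 show ?thesis
    by (simp add: inv_cayley_def cayley_def divide_simps) (simp add: algebra_simps)
qed

lemma holomorphic_cayley: "a \<in> upper_half_plane \<Longrightarrow> cayley a holomorphic_on upper_half_plane"
  unfolding cayley_def by (intro holomorphic_intros) (use half_plane_neq_cnj in auto)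

lemma holomorphic_inv_cayley: "inv_cayley a holomorphic_on ball 0 1"
  unfolding inv_cayley_def by (intro holomorphic_intros) auto

lemma open_upper_half_plane: "open upper_half_plane"
  unfolding upper_half_plane_def by (rule open_halfspace_Im_gt)

text \<open>
  The Schwarz lemma for \<open>cayley (Q a) \<circ> Q \<circ> inv_cayley a\<close>, which fixes 0.
\<close>
lemma Schwarz_Pick_half_plane:
  assumes Q: "Q holomorphic_on upper_half_plane" "Q ` upper_half_plane \<subseteq> upper_half_plane"
    and a: "a \<in> upper_half_plane"
  shows "z \<in> upper_half_plane \<Longrightarrow> cmod (cayley (Q a) (Q z)) \<le> cmod (cayley a z)"
    and "cmod (deriv Q a) * Im a \<le> Im (Q a)"
    and "cmod (deriv Q a) * Im a = Im (Q a) \<Longrightarrow>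
      \<exists>\<alpha>. cmod \<alpha> = 1 \<and> (\<forall>z\<in>upper_half_plane. cayley (Q a) (Q z) = \<alpha> * cayley a z)"
proof -
  let ?H = upper_half_plane
  have Qa: "Q a \<in> ?H" using Q a by auto
  define h where "h = (\<lambda>w. cayley (Q a) (Q (inv_cayley a w)))"
  have h_eq: "h (cayley a z) = cayley (Q a) (Q z)" if "z \<in> ?H" for z
    using that a by (simp add: h_def inv_cayley_cayley)
  have "(\<lambda>w. Q (inv_cayley a w)) holomorphic_on ball 0 1"
    by (rule holomorphic_on_compose_fun[OF holomorphic_inv_cayley Q(1) inv_cayley_in_half_plane[OF a]])
  then have holh: "h holomorphic_on ball 0 1"
    unfolding h_def by (rule holomorphic_on_compose_fun[OF _ holomorphic_cayley[OF Qa]])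
      (use Q(2) inv_cayley_in_half_plane[OF a] in blast)
  have h0: "h 0 = 0" by (simp add: h_def inv_cayley_def cayley_def)
  have h1: "cmod (h w) < 1" if "cmod w < 1" for w
    using cayley_in_ball[OF Qa, of "Q (inv_cayley a w)"] Q(2) inv_cayley_in_half_plane[OF a, of w] that
    by (auto simp: h_def)
  note SL = Schwarz_Lemma[OF holh h0 h1]
  show "cmod (cayley (Q a) (Q z)) \<le> cmod (cayley a z)" if z: "z \<in> ?H"
    using SL(1)[of "cayley a z"] cayley_in_ball[OF a z] h_eq[OF z] by simp
  have dQ: "(Q has_field_derivative deriv Q a) (at a)"
    using Q(1) a open_upper_half_plane by (simp add: holomorphic_derivI)
  have ic0: "inv_cayley a 0 = a" by (simp add: inv_cayley_def)
  have d1: "(inv_cayley a has_field_derivative (a - cnj a)) (at 0)"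
    unfolding inv_cayley_def by (auto intro!: derivative_eq_intros)
  have d2: "(cayley (Q a) has_field_derivative 1 / (Q a - cnj (Q a))) (at (Q a))"
    unfolding cayley_def using half_plane_neq_cnj[OF Qa Qa]
    by (auto intro!: derivative_eq_intros simp: divide_simps)
  have "((\<lambda>w. Q (inv_cayley a w)) has_field_derivative deriv Q a * (a - cnj a)) (at 0)"
    using DERIV_chain2[of Q "deriv Q a" "inv_cayley a" 0] dQ d1 ic0 by simp
  then have "(h has_field_derivative 1 / (Q a - cnj (Q a)) * (deriv Q a * (a - cnj a))) (at 0)"
    unfolding h_def by (rule DERIV_chain2[rotated]) (simp add: ic0 d2)
  then have dh: "deriv h 0 = 1 / (Q a - cnj (Q a)) * (deriv Q a * (a - cnj a))"
    by (rule DERIV_imp_deriv)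
  have *: "cmod (u - cnj u) = 2 * Im u" if "u \<in> ?H" for u
    using that by (simp add: complex_diff_cnj norm_mult upper_half_plane_def)
  have nd: "cmod (deriv h 0) = cmod (deriv Q a) * Im a / Im (Q a)"
    by (simp add: dh norm_mult norm_divide *[OF a] *[OF Qa])
  have "Im (Q a) > 0" using Qa by (simp add: upper_half_plane_def)
  then show "cmod (deriv Q a) * Im a \<le> Im (Q a)"
    using SL(2)[of 0] nd by (simp add: divide_simps)
  assume "cmod (deriv Q a) * Im a = Im (Q a)"
  then have "cmod (deriv h 0) = 1" using nd \<open>Im (Q a) > 0\<close> by simp
  then obtain \<alpha> where \<alpha>: "\<And>z. cmod z < 1 \<Longrightarrow> h z = \<alpha> * z" "cmod \<alpha> = 1"
    using SL(3)[of 0] by auto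
  show "\<exists>\<alpha>. cmod \<alpha> = 1 \<and> (\<forall>z\<in>?H. cayley (Q a) (Q z) = \<alpha> * cayley a z)"
    using \<alpha> h_eq cayley_in_ball[OF a] by (intro exI[of _ \<alpha>]) auto
qed

section \<open>Uniformisation of a domain with a reflection\<close>

text \<open>
  The equation says that \<open>w \<mapsto> cnj (h w)\<close> is an involution of the disc. The Schwarz lemma,
  applied to \<open>h\<close> at \<open>w\<close> and at \<open>cnj (h w)\<close>, gives both inequalities between the moduli of
  \<open>h w\<close> and \<open>w\<close>, so \<open>h\<close> is in the case of equality.
\<close>
lemma cnj_self_inverse_rotation:
  assumes h: "h holomorphic_on ball 0 1" "h 0 = 0" "\<And>w. cmod w < 1 \<Longrightarrow> cmod (h w) < 1"
    and inv: "\<And>w. cmod w < 1 \<Longrightarrow> h (cnj (h w)) = cnj w"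
  obtains \<alpha> where "cmod \<alpha> = 1" "\<And>w. cmod w < 1 \<Longrightarrow> h w = \<alpha> * w"
proof -
  note SL = Schwarz_Lemma[OF h]
  let ?w = "1/2 :: complex"
  have "cmod ?w \<le> cmod (h ?w)"
    using SL(1)[of "cnj (h ?w)"] inv[of ?w] h(3)[of ?w] by simp
  moreover have "cmod (h ?w) \<le> cmod ?w" using SL(1)[of ?w] by simp
  ultimately have "cmod (h ?w) = cmod ?w" by linarith
  then have "\<exists>z. cmod z < 1 \<and> z \<noteq> 0 \<and> cmod (h z) = cmod z"
    by (intro exI[of _ ?w]) auto
  then show thesis using SL(3)[of 0] that by auto
qed

text \<open>
  A Riemann map of \<open>U\<close> can be chosen to carry \<open>F\<close> to the reflection in the imaginary axis.
  Normalise a Riemann map to the disc so that a fixed point of \<open>F\<close> goes to 0. Then \<open>F\<close> becomes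
  \<open>w \<mapsto> cnj \<alpha> * cnj w\<close> with \<open>\<alpha>\<close> unimodular, and rotating by a square root of \<open>\<alpha>\<close> turns this
  into complex conjugation, which \<open>inv_cayley \<i>\<close> carries to the half-plane. A connected set
  without fixed points lies on one side of the axis; which side can be chosen.
\<close>
lemma reflection_uniformization:
  assumes U: "open U" "simply_connected U" "U \<noteq> UNIV"
    and F: "F anti_holomorphic_on U" "\<And>z. z \<in> U \<Longrightarrow> F z \<in> U \<and> F (F z) = z"
    and z0: "z0 \<in> U" "F z0 = z0"
    and S: "connected S" "S \<subseteq> U" "\<And>z. z \<in> S \<Longrightarrow> F z \<noteq> z"
  obtains Q R where "Q holomorphic_on upper_half_plane" "R holomorphic_on U"
    "\<And>z. z \<in> upper_half_plane \<Longrightarrow> Q z \<in> U \<and> R (Q z) = z"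
    "\<And>z. z \<in> U \<Longrightarrow> R z \<in> upper_half_plane \<and> Q (R z) = z"
    "\<And>z. z \<in> U \<Longrightarrow> R (F z) = - cnj (R z)"
    "\<And>z. z \<in> S \<Longrightarrow> 0 < Re (R z)"
proof -
  let ?H = upper_half_plane
  obtain f0 g0 where f0: "f0 holomorphic_on U" "\<And>z. z \<in> U \<Longrightarrow> f0 z \<in> ball 0 1 \<and> g0 (f0 z) = z"
    and g0: "g0 holomorphic_on ball 0 1" "\<And>z. z \<in> ball 0 1 \<Longrightarrow> g0 z \<in> U \<and> f0 (g0 z) = z"
    using Riemann_mapping_theorem[of U] U z0 by (metis empty_iff)
  obtain M N where M: "M (f0 z0) = 0" "M holomorphic_on ball 0 1" "M ` ball 0 1 \<subseteq> ball 0 1"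
    and N: "N holomorphic_on ball 0 1" "N ` ball 0 1 \<subseteq> ball 0 1"
    and MN: "\<And>z. z \<in> ball 0 1 \<Longrightarrow> M (N z) = z" "\<And>z. z \<in> ball 0 1 \<Longrightarrow> N (M z) = z"
    using ball_biholomorphism_exists[of "f0 z0"] f0(2)[OF z0(1)] by metis
  define f where "f = (\<lambda>z. M (f0 z))"
  define g where "g = (\<lambda>w. g0 (N w))"
  have holf: "f holomorphic_on U"
    unfolding f_def by (rule holomorphic_on_compose_fun[OF f0(1) M(2)]) (use f0(2) in blast)
  have holg: "g holomorphic_on ball 0 1"
    unfolding g_def by (rule holomorphic_on_compose_fun[OF N(1) g0(1)]) (use N(2) in blast)
  have f: "f z \<in> ball 0 1 \<and> g (f z) = z" if "z \<in> U" for z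
    using f0(2)[OF that] M(3) MN(2)[of "f0 z"] unfolding f_def g_def by (metis image_subset_iff)
  have g: "g w \<in> U \<and> f (g w) = w" if "w \<in> ball 0 1" for w
    using g0(2)[of "N w"] N(2) MN(1)[OF that] that unfolding f_def g_def by (metis image_subset_iff)
  have fz0: "f z0 = 0" by (simp add: f_def M)
  have gz0: "g 0 = z0" using f[OF z0(1)] fz0 by simp
  define h where "h = (\<lambda>w. cnj (f (F (g w))))"
  have holh: "h holomorphic_on ball 0 1"
  proof -
    have cU: "cnj ` cnj ` U = U" by (simp add: image_image)
    have "open (cnj ` U)" using U(1) unfolding image_cnj_conv_vimage_cnj by (intro open_vimage) (auto intro: continuous_intros)
    then have 1: "cnj \<circ> f \<circ> cnj holomorphic_on cnj ` U"
      using holomorphic_on_compose_cnj_cnj[of f "cnj ` U"] holf cU by simp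
    have 2: "(\<lambda>z. cnj (F z)) holomorphic_on U" using F(1) by (simp add: anti_holomorphic_on_def)
    have 3: "(\<lambda>w. cnj (F (g w))) holomorphic_on ball 0 1"
      by (rule holomorphic_on_compose_fun[OF holg 2]) (use g in blast)
    have "(\<lambda>w. (cnj \<circ> f \<circ> cnj) (cnj (F (g w)))) holomorphic_on ball 0 1"
      by (rule holomorphic_on_compose_fun[OF 3 1]) (use g F(2) in blast)
    then show ?thesis by (simp add: h_def o_def)
  qed
  have h: "h 0 = 0" "\<And>w. cmod w < 1 \<Longrightarrow> cmod (h w) < 1" "\<And>w. cmod w < 1 \<Longrightarrow> h (cnj (h w)) = cnj w"
    using f g F(2) z0 fz0 gz0 by (auto simp: h_def)
  obtain \<alpha> where \<alpha>: "cmod \<alpha> = 1" "\<And>w. cmod w < 1 \<Longrightarrow> h w = \<alpha> * w"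
    using cnj_self_inverse_rotation[OF holh h] by blast
  \<comment> \<open>Rotating the disc by \<open>\<beta>\<close> multiplies \<open>cnj \<alpha>\<close> by \<open>\<beta>\<^sup>2\<close>, so this choice removes the factor.\<close>
  define \<beta> where "\<beta> = csqrt \<alpha>"
  have \<beta>2: "\<beta> * \<beta> = \<alpha>" by (simp add: \<beta>_def flip: power2_eq_square)
  have \<beta>1: "cmod \<beta> = 1" by (simp add: \<beta>_def \<alpha>(1))
  then have \<beta>c: "\<beta> * cnj \<beta> = 1" using complex_norm_square[of \<beta>] by simp
  have fF: "f (F z) = cnj \<alpha> * cnj (f z)" if "z \<in> U" for z
  proof -
    have "h (f z) = \<alpha> * f z" using \<alpha>(2) f[OF that] by simp
    then have "cnj (f (F z)) = \<alpha> * f z" using f[OF that] by (simp add: h_def)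
    then show ?thesis by (metis complex_cnj_cnj complex_cnj_mult)
  qed
  have i: "\<i> \<in> ?H" by (simp add: upper_half_plane_def)
  define R where "R = (\<lambda>z. inv_cayley \<i> (\<beta> * f z))"
  define Q where "Q = (\<lambda>z. g (cnj \<beta> * cayley \<i> z))"
  have \<beta>ball: "\<beta> * w \<in> ball 0 1" "cnj \<beta> * w \<in> ball 0 1" if "w \<in> ball 0 1" for w
    using that \<beta>1 by (auto simp: norm_mult)
  have holR: "R holomorphic_on U"
    unfolding R_def by (rule holomorphic_on_compose_fun[OF _ holomorphic_inv_cayley, where f="\<lambda>z. \<beta> * f z"])
      (use f \<beta>ball in \<open>auto intro!: holomorphic_intros holf simp del: mem_ball mem_ball_0\<close>)
  have holQ: "Q holomorphic_on ?H"
    unfolding Q_def by (rule holomorphic_on_compose_fun[OF _ holg])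
      (use \<beta>ball cayley_in_ball[OF i] in \<open>auto intro!: holomorphic_intros holomorphic_cayley[OF i] simp del: mem_ball mem_ball_0\<close>)
  have R: "R z \<in> ?H \<and> Q (R z) = z" if "z \<in> U" for z
  proof -
    have eq: "cnj \<beta> * (\<beta> * f z) = f z" using \<beta>c by (metis mult.assoc mult.commute mult_1)
    have "\<beta> * f z \<in> ball 0 1" using f[OF that] \<beta>ball by blast
    then have "cayley \<i> (R z) = \<beta> * f z" "R z \<in> ?H"
      unfolding R_def by (rule cayley_inv_cayley[OF i], rule inv_cayley_in_half_plane[OF i])
    then show ?thesis using f[OF that] by (simp only: Q_def eq simp_thms)
  qed
  have Q: "Q z \<in> U \<and> R (Q z) = z" if "z \<in> ?H" for z
  proof -
    have eq: "\<beta> * (cnj \<beta> * cayley \<i> z) = cayley \<i> z" using \<beta>c by (metis mult.assoc mult_1)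
    have "cnj \<beta> * cayley \<i> z \<in> ball 0 1" using \<beta>ball cayley_in_ball[OF i that] by blast
    then have "f (Q z) = cnj \<beta> * cayley \<i> z" "Q z \<in> U" unfolding Q_def using g by blast+
    then show ?thesis by (simp only: R_def eq inv_cayley_cayley[OF i that] simp_thms)
  qed
  have RF: "R (F z) = - cnj (R z)" if "z \<in> U" for z
  proof -
    have "\<beta> * f (F z) = (\<beta> * cnj \<beta>) * cnj \<beta> * cnj (f z)"
      using fF[OF that] by (simp flip: \<beta>2)
    then have "\<beta> * f (F z) = cnj (\<beta> * f z)" using \<beta>c by simp
    moreover have "inv_cayley \<i> (cnj w) = - cnj (inv_cayley \<i> w)" for w
      by (simp add: inv_cayley_def minus_divide_left)
    ultimately show ?thesis by (simp only: R_def)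
  qed
  have nz: "Re (R z) \<noteq> 0" if "z \<in> S" for z
  proof
    assume "Re (R z) = 0"
    then have "- cnj (R z) = R z" by (simp add: complex_eq_iff)
    then have "Q (R (F z)) = Q (R z)" using RF that S(2) by (metis subsetD)
    then show False using R F(2) S that by (metis subsetD)
  qed
  have "connected (R ` S)"
    by (intro connected_continuous_image holomorphic_on_imp_continuous_on holomorphic_on_subset[OF holR] S)
  then have "connected ((\<lambda>z. Re (R z)) ` S)"
    using connected_continuous_image[of "R ` S" Re] by (simp add: image_image continuous_on_Re)
  then have iv: "is_interval ((\<lambda>z. Re (R z)) ` S)" by (simp add: is_interval_connected_1)
  have dich: "(\<forall>z\<in>S. 0 < Re (R z)) \<or> (\<forall>z\<in>S. Re (R z) < 0)"
  proof (rule ccontr)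
    assume "\<not> ?thesis"
    then obtain z1 z2 where "z1 \<in> S" "z2 \<in> S" "Re (R z1) \<le> 0" "0 \<le> Re (R z2)" by force
    then have "0 \<in> (\<lambda>z. Re (R z)) ` S" using iv unfolding is_interval_1 by blast
    then show False using nz by auto
  qed
  show thesis
  proof (cases "\<forall>z\<in>S. 0 < Re (R z)")
    case True
    with that[OF holQ holR Q R RF] show thesis by blast
  next
    case False
    \<comment> \<open>The rotation \<open>z \<mapsto> - 1 / z\<close> about \<open>\<i>\<close> commutes with the reflection and exchanges the two sides.\<close>
    have rot: "- 1 / z \<in> ?H \<and> Re (- 1 / z) = - Re z / (cmod z)\<^sup>2" if "z \<in> ?H" for z
      using that by (auto simp: upper_half_plane_def Re_divide Im_divide cmod_power2 intro!: divide_pos_pos add_nonneg_pos)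
    have n0: "z \<noteq> 0" if "z \<in> ?H" for z using that by (auto simp: upper_half_plane_def)
    show thesis
    proof (rule that[of "\<lambda>z. Q (- 1 / z)" "\<lambda>z. - 1 / R z"])
      have "(\<lambda>z. - 1 / z) holomorphic_on ?H" by (intro holomorphic_intros) (use n0 in auto)
      from holomorphic_on_compose_fun[OF this holQ] rot
      show "(\<lambda>z. Q (- 1 / z)) holomorphic_on ?H" by blast
      show "(\<lambda>z. - 1 / R z) holomorphic_on U" by (intro holomorphic_intros holR) (use R n0 in auto)
      fix z
      show "Q (- 1 / z) \<in> U \<and> - 1 / R (Q (- 1 / z)) = z" if "z \<in> ?H" using Q[of "- 1 / z"] rot[OF that] by simp
      show "- 1 / R z \<in> ?H \<and> Q (- 1 / (- 1 / R z)) = z" if "z \<in> U" using R[OF that] rot by simp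
      show "- 1 / R (F z) = - cnj (- 1 / R z)" if "z \<in> U" using RF[OF that] by simp
      show "0 < Re (- 1 / R z)" if "z \<in> S"
      proof -
        have z: "R z \<in> ?H" "Re (R z) < 0" using dich False that R S(2) by auto
        then have "0 < - Re (R z) / (cmod (R z))\<^sup>2" using n0 by (intro divide_pos_pos) auto
        then show ?thesis using rot[OF z(1)] by simp
      qed
    qed
  qed
qed

section \<open>The integral of the height along the imaginary axis\<close>

text \<open>
  Points at bounded hyperbolic distance from \<open>u\<close> have Euclidean distance from \<open>u\<close> at most a
  multiple of the height of \<open>u\<close>. It makes the boundary limit along one line propagate to all
  lines at bounded hyperbolic distance.
\<close>
lemma half_plane_dist_via_cayley:
  assumes u: "u \<in> upper_half_plane" and \<rho>: "cmod (cayley u v) \<le> \<rho>" "\<rho> < 1" and v: "v \<in> upper_half_plane"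
  shows "cmod (v - u) \<le> 2 * \<rho> / (1 - \<rho>) * Im u"
proof -
  have n: "v - cnj u \<noteq> 0" using half_plane_neq_cnj[OF u v] by simp
  have \<rho>0: "0 \<le> \<rho>" using \<rho>(1) norm_ge_zero order_trans by blast
  have "cmod (v - u) \<le> \<rho> * cmod (v - cnj u)"
    using \<rho>(1) n by (simp add: cayley_def norm_divide divide_simps)
  also have "cmod (v - cnj u) \<le> cmod (v - u) + cmod (u - cnj u)"
    using norm_triangle_ineq[of "v - u" "u - cnj u"] by simp
  also have "cmod (u - cnj u) = 2 * Im u"
    using u by (simp add: complex_diff_cnj norm_mult upper_half_plane_def)
  finally have "cmod (v - u) \<le> \<rho> * (cmod (v - u) + 2 * Im u)"
    using \<rho>0 by (simp add: mult_left_mono)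
  then have "(1 - \<rho>) * cmod (v - u) \<le> 2 * \<rho> * Im u" by (simp add: algebra_simps)
  then show ?thesis using \<rho>(2) by (simp add: field_simps)
qed

text \<open>
  The bound does not depend on \<open>x\<close> because translations of the strip are hyperbolic isometries.
\<close>
lemma cayley_exp_sin:
  assumes "y0 \<le> y" "y \<le> pi / 2" "0 < y0"
  shows "cmod (cayley (exp (Complex x (pi/2))) (exp (Complex x y))) \<le> sqrt ((1 - sin y0) / (1 + sin y0))"
proof -
  have s: "sin y0 \<le> sin y" "0 < sin y0" "sin y \<le> 1"
    using assms pi_gt_zero by (auto intro!: sin_monotone_2pi_le sin_gt_zero)
  have e: "exp (Complex x y) = of_real (exp x) * cis y" for y
    by (simp add: exp_eq_polar)
  have "cayley (exp (Complex x (pi/2))) (exp (Complex x y))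
      = (of_real (exp x) * (cis y - \<i>)) / (of_real (exp x) * (cis y + \<i>))"
    unfolding e cayley_def by (simp add: cis_pi_half algebra_simps)
  also have "\<dots> = (cis y - \<i>) / (cis y + \<i>)" by simp
  finally have "(cmod (cayley (exp (Complex x (pi/2))) (exp (Complex x y))))\<^sup>2
      = (cmod (cis y - \<i>))\<^sup>2 / (cmod (cis y + \<i>))\<^sup>2"
    by (simp add: norm_divide power_divide)
  also have "(cmod (cis y - \<i>))\<^sup>2 = 2 * (1 - sin y)"
    unfolding cmod_power2 using sin_cos_squared_add[of y] by (simp add: power2_eq_square algebra_simps)
  also have "(cmod (cis y + \<i>))\<^sup>2 = 2 * (1 + sin y)"
    unfolding cmod_power2 using sin_cos_squared_add[of y] by (simp add: power2_eq_square algebra_simps)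
  also have "2 * (1 - sin y) / (2 * (1 + sin y)) = (1 - sin y) / (1 + sin y)"
    by (rule mult_divide_mult_cancel_left) simp
  also have "\<dots> \<le> (1 - sin y0) / (1 + sin y0)"
    using s by (intro frac_le) auto
  finally show ?thesis by (simp add: real_le_rsqrt)
qed

text \<open>
  This computes how much \<open>Im Q\<close> can accumulate along the imaginary axis in its hyperbolic
  parameter. Let \<open>\<phi> z = Q (exp z)\<close> on the strip of width \<open>pi\<close>, and let \<open>\<Phi>\<close> be a primitive of
  \<open>\<phi>\<close>; the function wanted is \<open>Im \<Phi>\<close> on the middle line. In place of a contour integral,
  \<open>Im \<Phi>\<close> is followed around the rectangle with horizontal sides on the line of height \<open>y\<close> close
  to 0 and on the middle line. The lower side contributes nothing in the limit, because \<open>Im Q\<close>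
  vanishes at the positive real axis. On the vertical sides the derivative of \<open>Im \<Phi>\<close> is
  \<open>Re \<phi>\<close>, which tends to \<open>p\<close> and \<open>q\<close>: these are the limits on the middle line by hypothesis, and on
  the other lines by Schwarz-Pick, since hyperbolic distances from the middle line stay bounded.
  The sides have length \<open>pi / 2\<close>, whence the bound.
\<close>
lemma half_plane_height_primitive:
  fixes Q :: "complex \<Rightarrow> complex" and p q :: real
  assumes Q: "Q holomorphic_on upper_half_plane" "Q ` upper_half_plane \<subseteq> upper_half_plane"
    and M: "\<And>w. w \<in> upper_half_plane \<Longrightarrow> 0 < Re w \<Longrightarrow> cmod (Q w) \<le> M"
    and bottom: "\<And>c. 0 < c \<Longrightarrow>
      \<exists>d>0. \<forall>w\<in>upper_half_plane. 0 < Re w \<and> Im w < d \<longrightarrow> Im (Q w) < c"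
    and p: "((\<lambda>x. Q (\<i> * of_real (exp x))) \<longlongrightarrow> of_real p) at_top"
    and q: "((\<lambda>x. Q (\<i> * of_real (exp x))) \<longlongrightarrow> of_real q) at_bot"
  obtains V where "\<And>x. (V has_real_derivative Im (Q (\<i> * of_real (exp x)))) (at x)"
    "\<And>a b. a \<le> b \<Longrightarrow> V b - V a \<le> pi / 2 * \<bar>p - q\<bar>"
proof -
  let ?H = upper_half_plane
  define T where "T = {z. 0 < Im z \<and> Im z < pi}"
  define \<phi> where "\<phi> = (\<lambda>z. Q (exp z))"
  have expH: "exp z \<in> ?H" if "z \<in> T" for z
    using that by (simp add: T_def upper_half_plane_def Im_exp sin_gt_zero)
  have openT: "open T"
    unfolding T_def by (intro open_Collect_conj open_halfspace_Im_gt open_halfspace_Im_lt)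
  have convT: "convex T"
    unfolding T_def Collect_conj_eq by (intro convex_Int convex_halfspace_Im_gt convex_halfspace_Im_lt)
  have hol\<phi>: "\<phi> holomorphic_on T"
    unfolding \<phi>_def by (rule holomorphic_on_compose_fun[OF _ Q(1) expH]) (auto intro: holomorphic_intros)
  have \<phi>H: "\<phi> z \<in> ?H" if "z \<in> T" for z
    using expH[OF that] Q(2) by (auto simp: \<phi>_def)
  obtain \<Phi> where \<Phi>: "\<And>z. z \<in> T \<Longrightarrow> (\<Phi> has_field_derivative \<phi> z) (at z)"
    using holomorphic_convex_primitive'[OF convT openT hol\<phi>] openT by (metis at_within_open)
  have dx: "((\<lambda>x. Im (\<Phi> (Complex x y))) has_real_derivative Im (\<phi> (Complex x y))) (at x)"
    if "0 < y" "y < pi" for x y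
  proof -
    have "((\<lambda>x. Complex x y) has_vector_derivative 1) (at x)"
      unfolding has_vector_derivative_complex_iff by (auto intro!: derivative_eq_intros)
    moreover have "(\<Phi> has_field_derivative \<phi> (Complex x y)) (at (Complex x y))"
      by (rule \<Phi>) (use that in \<open>simp add: T_def\<close>)
    ultimately have "((\<Phi> \<circ> (\<lambda>x. Complex x y)) has_vector_derivative 1 * \<phi> (Complex x y)) (at x)"
      by (rule field_vector_diff_chain_at)
    then show ?thesis
      unfolding has_vector_derivative_complex_iff by (simp add: o_def)
  qed
  have dy: "((\<lambda>y. Im (\<Phi> (Complex x y))) has_real_derivative Re (\<phi> (Complex x y))) (at y)"
    if "0 < y" "y < pi" for x y
  proof -
    have "((\<lambda>y. Complex x y) has_vector_derivative \<i>) (at y)"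
      unfolding has_vector_derivative_complex_iff by (auto intro!: derivative_eq_intros)
    moreover have "(\<Phi> has_field_derivative \<phi> (Complex x y)) (at (Complex x y))"
      by (rule \<Phi>) (use that in \<open>simp add: T_def\<close>)
    ultimately have "((\<Phi> \<circ> (\<lambda>y. Complex x y)) has_vector_derivative \<i> * \<phi> (Complex x y)) (at y)"
      by (rule field_vector_diff_chain_at)
    then show ?thesis
      unfolding has_vector_derivative_complex_iff by (simp add: o_def)
  qed
  have line: "exp (Complex x (pi/2)) = \<i> * of_real (exp x)" for x
    by (simp add: exp_eq_polar cis_pi_half mult.commute)
  define V where "V = (\<lambda>x. Im (\<Phi> (Complex x (pi/2))))"
  have dV: "(V has_real_derivative Im (Q (\<i> * of_real (exp x)))) (at x)" for x
    using dx[of "pi/2" x] by (simp add: V_def \<phi>_def line)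
  have lineH: "\<i> * of_real (exp x) \<in> ?H" for x by (simp add: upper_half_plane_def)
  define E where "E = (\<lambda>R y. Im (\<Phi> (Complex R y)) - Im (\<Phi> (Complex (- R) y)))"
  have vert: "E R y2 - E R y1 \<le> D * (y2 - y1)"
    if "0 < y1" "y1 \<le> y2" "y2 \<le> pi/2"
      and D: "\<And>y. y1 \<le> y \<Longrightarrow> y < pi/2 \<Longrightarrow> Re (\<phi> (Complex R y)) - Re (\<phi> (Complex (-R) y)) \<le> D" for R y1 y2 D
  proof (cases "y1 = y2")
    case False
    then have "y1 < y2" using that by simp
    moreover have "((\<lambda>y. E R y) has_real_derivative Re (\<phi> (Complex R y)) - Re (\<phi> (Complex (-R) y))) (at y)"
      if "y1 \<le> y" "y \<le> y2" for y
      unfolding E_def by (intro DERIV_diff dy) (use that \<open>0 < y1\<close> \<open>y2 \<le> pi/2\<close> pi_gt_zero in linarith)+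
    ultimately obtain z where "z > y1" "z < y2"
      "E R y2 - E R y1 = (y2 - y1) * (Re (\<phi> (Complex R z)) - Re (\<phi> (Complex (-R) z)))"
      using MVT2[of y1 y2 "E R" "\<lambda>y. Re (\<phi> (Complex R y)) - Re (\<phi> (Complex (-R) y))"] by blast
    then show ?thesis using D[of z] \<open>y1 < y2\<close> that(3)
      by (simp add: mult.commute mult_left_mono)
  qed simp
  have quad: "cmod (\<phi> (Complex x y)) \<le> M" if "0 < y" "y < pi/2" for x y
    unfolding \<phi>_def
  proof (rule M)
    show "exp (Complex x y) \<in> ?H" using expH that pi_gt_zero by (simp add: T_def)
    show "0 < Re (exp (Complex x y))" using that by (simp add: Re_exp cos_gt_zero)
  qed
  have M0: "0 \<le> M" using quad[of "pi/4" 0] norm_ge_zero[of "\<phi> (Complex 0 (pi/4))"] pi_gt_zero by linarith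
  have E0: "E R y \<le> 2 * M * y" if R: "0 < R" and y: "0 < y" "y \<le> pi/2" for R y
  proof (rule field_le_epsilon)
    fix e :: real assume e: "0 < e"
    obtain d where d: "d > 0" "\<And>w. w \<in> ?H \<Longrightarrow> 0 < Re w \<Longrightarrow> Im w < d \<Longrightarrow> Im (Q w) < e / (2 * R)"
      using bottom[OF divide_pos_pos[OF e, of "2 * R"]] R by auto
    \<comment> \<open>Low enough that \<open>exp\<close> maps the side at height \<open>y1\<close> below height \<open>d\<close>, as \<open>sin y1 \<le> y1\<close>.\<close>
    define y1 where "y1 = min (y / 2) (d / (2 * exp R))"
    have "0 < y1" unfolding y1_def using y(1) d(1) by simp
    moreover have "y1 \<le> y / 2" unfolding y1_def by (rule min.cobounded1)
    ultimately have y1: "0 < y1" "y1 \<le> y" "y1 < pi/2" using y by linarith+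
    have small: "Im (\<phi> (Complex x y1)) < e / (2 * R)" if x: "x \<le> R" for x
      unfolding \<phi>_def
    proof (rule d(2))
      show "exp (Complex x y1) \<in> ?H" using expH y1 pi_gt_zero by (simp add: T_def)
      show "0 < Re (exp (Complex x y1))" using y1 by (simp add: Re_exp cos_gt_zero)
      have "Im (exp (Complex x y1)) = exp x * sin y1" by (simp add: Im_exp)
      also have "\<dots> \<le> exp R * y1"
      proof (rule mult_mono)
        show "0 \<le> sin y1" by (rule sin_ge_zero) (use y1 in linarith)+
        show "sin y1 \<le> y1" by (rule sin_x_le_x) (use y1 in linarith)
      qed (use x in auto)
      also have "\<dots> \<le> exp R * (d / (2 * exp R))" unfolding y1_def by (intro mult_left_mono min.cobounded2) simp
      also have "\<dots> < d" using d(1) by simp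
      finally show "Im (exp (Complex x y1)) < d" .
    qed
    have "\<exists>z>-R. z < R \<and> Im (\<Phi> (Complex R y1)) - Im (\<Phi> (Complex (-R) y1)) = (R - (-R)) * Im (\<phi> (Complex z y1))"
      by (rule MVT2) (use R y1 pi_gt_zero in \<open>auto intro!: dx\<close>)
    then obtain z where z: "z < R" "E R y1 = 2 * R * Im (\<phi> (Complex z y1))"
      by (auto simp: E_def)
    have "E R y1 \<le> 2 * R * (e / (2 * R))"
      unfolding z(2) using small[of z] z(1) R by (intro mult_left_mono) auto
    then have "E R y1 \<le> e" using R by simp
    moreover have "E R y - E R y1 \<le> 2 * M * (y - y1)"
    proof (rule vert[OF y1(1,2) y(2)])
      fix y' assume y': "y1 \<le> y'" "y' < pi/2"
      have "\<bar>Re (\<phi> (Complex R y'))\<bar> \<le> M" "\<bar>Re (\<phi> (Complex (-R) y'))\<bar> \<le> M"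
        using quad[of y' R] quad[of y' "-R"] y' y1 abs_Re_le_cmod[of "\<phi> (Complex R y')"]
          abs_Re_le_cmod[of "\<phi> (Complex (-R) y')"] by linarith+
      then show "Re (\<phi> (Complex R y')) - Re (\<phi> (Complex (-R) y')) \<le> 2 * M" by linarith
    qed
    moreover have "2 * M * (y - y1) \<le> 2 * M * y" using M0 y1 by (intro mult_left_mono) auto
    ultimately show "E R y \<le> 2 * M * y + e" by linarith
  qed
  have near: "\<exists>C. \<forall>x y. y0 \<le> y \<longrightarrow> y \<le> pi/2 \<longrightarrow>
      \<bar>Re (\<phi> (Complex x y)) - Re (Q (\<i> * of_real (exp x)))\<bar> \<le> C * Im (Q (\<i> * of_real (exp x)))"
    if y0: "0 < y0" "y0 < pi/2" for y0
  proof -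
    define \<rho> where "\<rho> = sqrt ((1 - sin y0) / (1 + sin y0))"
    have "0 < sin y0" using y0 pi_gt_zero by (intro sin_gt_zero) auto
    then have \<rho>1: "\<rho> < 1" unfolding \<rho>_def by (simp add: divide_simps)
    show ?thesis
    proof (intro exI allI impI)
      fix x y assume y: "y0 \<le> y" "y \<le> pi/2"
      let ?a = "exp (Complex x (pi/2))" and ?z = "exp (Complex x y)"
      have H: "?a \<in> ?H" "?z \<in> ?H" using expH y y0 pi_gt_zero by (auto simp: T_def)
      have "cmod (cayley (Q ?a) (Q ?z)) \<le> \<rho>"
        using Schwarz_Pick_half_plane(1)[OF Q H] cayley_exp_sin[OF y y0(1), of x] unfolding \<rho>_def by linarith
      then have "cmod (Q ?z - Q ?a) \<le> 2 * \<rho> / (1 - \<rho>) * Im (Q ?a)"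
        using H Q(2) \<rho>1 by (intro half_plane_dist_via_cayley) auto
      moreover have "\<bar>Re (Q ?z) - Re (Q ?a)\<bar> \<le> cmod (Q ?z - Q ?a)"
        using abs_Re_le_cmod[of "Q ?z - Q ?a"] by simp
      ultimately show "\<bar>Re (\<phi> (Complex x y)) - Re (Q (\<i> * of_real (exp x)))\<bar>
          \<le> 2 * \<rho> / (1 - \<rho>) * Im (Q (\<i> * of_real (exp x)))"
        unfolding \<phi>_def line by linarith
    qed
  qed
  have ends: "\<forall>\<^sub>F R in at_top. \<forall>y. y0 \<le> y \<longrightarrow> y < pi/2 \<longrightarrow>
      Re (\<phi> (Complex R y)) - Re (\<phi> (Complex (-R) y)) \<le> \<bar>p - q\<bar> + \<delta>"
    if y0: "0 < y0" "y0 < pi/2" and \<delta>: "0 < \<delta>" for y0 \<delta>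
  proof -
    obtain C where C: "\<And>x y. y0 \<le> y \<Longrightarrow> y \<le> pi/2 \<Longrightarrow>
      \<bar>Re (\<phi> (Complex x y)) - Re (Q (\<i> * of_real (exp x)))\<bar> \<le> C * Im (Q (\<i> * of_real (exp x)))"
      using near[OF y0] by blast
    let ?g = "\<lambda>x. Q (\<i> * of_real (exp x))"
    have q': "((\<lambda>x. ?g (- x)) \<longlongrightarrow> of_real q) at_top"
      using filterlim_compose[OF q filterlim_uminus_at_bot_at_top] .
    have "((\<lambda>R. Re (?g R) - Re (?g (-R)) + (C * Im (?g R) + C * Im (?g (-R)))) \<longlongrightarrow>
        Re (of_real p) - Re (of_real q) + (C * Im (of_real p) + C * Im (of_real q))) at_top"
      by (intro tendsto_intros p q')
    then have "((\<lambda>R. Re (?g R) - Re (?g (-R)) + (C * Im (?g R) + C * Im (?g (-R)))) \<longlongrightarrow> p - q) at_top"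
      by simp
    then have "\<forall>\<^sub>F R in at_top. Re (?g R) - Re (?g (-R)) + (C * Im (?g R) + C * Im (?g (-R))) < \<bar>p - q\<bar> + \<delta>"
      by (rule order_tendstoD) (use \<delta> in linarith)
    then show ?thesis
    proof eventually_elim
      case (elim R)
      show ?case
      proof (intro allI impI)
        fix y assume y: "y0 \<le> y" "y < pi/2"
        show "Re (\<phi> (Complex R y)) - Re (\<phi> (Complex (-R) y)) \<le> \<bar>p - q\<bar> + \<delta>"
          using C[OF y(1), of R] C[OF y(1), of "-R"] y elim by linarith
      qed
    qed
  qed
  have mono: "V a \<le> V b" if "a \<le> b" for a b
  proof (rule DERIV_nonneg_imp_nondecreasing[OF that])
    fix x
    have "Q (\<i> * of_real (exp x)) \<in> ?H" using lineH[of x] Q(2) by blast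
    then have "0 \<le> Im (Q (\<i> * of_real (exp x)))" unfolding upper_half_plane_def by simp
    with dV[of x] show "\<exists>y. (V has_real_derivative y) (at x) \<and> 0 \<le> y" by blast
  qed
  have "V b - V a \<le> pi / 2 * \<bar>p - q\<bar>" if "a \<le> b" for a b
  proof (rule field_le_epsilon)
    fix e :: real assume e: "0 < e"
    \<comment> \<open>The two error terms below become at most \<open>e / 2\<close> each.\<close>
    define \<delta> where "\<delta> = e / pi"
    define y0 where "y0 = min (pi/4) (e / (4 * (M + 1)))"
    have \<delta>: "0 < \<delta>" using e by (simp add: \<delta>_def)
    have "0 < e / (4 * (M + 1))" using e M0 by (intro divide_pos_pos) auto
    then have "0 < y0" unfolding y0_def by simp
    moreover have "y0 \<le> pi/4" unfolding y0_def by (rule min.cobounded1)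
    ultimately have y0: "0 < y0" "y0 < pi/2" using pi_gt_zero by linarith+
    have "\<forall>\<^sub>F R in at_top. R > 0 \<and> \<bar>a\<bar> \<le> R \<and> \<bar>b\<bar> \<le> R"
      by (intro eventually_conj eventually_gt_at_top eventually_ge_at_top)
    from eventually_happens[OF eventually_conj[OF this ends[OF y0 \<delta>]]]
    obtain R where R: "R > 0" "\<bar>a\<bar> \<le> R" "\<bar>b\<bar> \<le> R"
      "\<And>y. y0 \<le> y \<Longrightarrow> y < pi/2 \<Longrightarrow> Re (\<phi> (Complex R y)) - Re (\<phi> (Complex (-R) y)) \<le> \<bar>p - q\<bar> + \<delta>"
      by auto
    have "V b - V a \<le> V R - V (-R)" using mono[of b R] mono[of "-R" a] R by linarith
    also have "\<dots> = E R (pi/2)" by (simp add: V_def E_def)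
    also have "\<dots> \<le> E R y0 + (\<bar>p - q\<bar> + \<delta>) * (pi/2 - y0)"
      using vert[of y0 "pi/2" R "\<bar>p - q\<bar> + \<delta>"] y0 R(4) by simp
    also have "\<dots> \<le> 2 * M * y0 + (\<bar>p - q\<bar> + \<delta>) * (pi/2)"
      using E0[OF R(1) y0(1)] y0 \<delta> by (intro add_mono mult_left_mono) auto
    also have "\<dots> = 2 * M * y0 + e / 2 + pi/2 * \<bar>p - q\<bar>"
      using pi_gt_zero by (simp add: \<delta>_def algebra_simps)
    also have "2 * M * y0 \<le> 2 * M * (e / (4 * (M + 1)))" using M0 by (intro mult_left_mono) (auto simp: y0_def)
    also have "\<dots> \<le> e / 2" using M0 e by (simp add: field_simps)
    finally show "V b - V a \<le> pi / 2 * \<bar>p - q\<bar> + e" by linarith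
  qed
  with dV that show thesis by blast
qed

section \<open>Curve length and reparametrisation\<close>

text \<open>
  The hypotheses concern interior parameters only; a partition that uses the end points is
  the limit of partitions whose parameters are clamped to \<open>[\<epsilon>, 1 - \<epsilon>]\<close>.
\<close>
lemma curve_length_le:
  fixes g :: "real \<Rightarrow> 'a::metric_space" and m :: "real \<Rightarrow> real"
  assumes g: "continuous_on {0..1} g"
    and m: "\<And>s t. 0 < s \<Longrightarrow> s \<le> t \<Longrightarrow> t < 1 \<Longrightarrow> dist (g s) (g t) \<le> m t - m s"
    and K: "\<And>s t. 0 < s \<Longrightarrow> s \<le> t \<Longrightarrow> t < 1 \<Longrightarrow> m t - m s \<le> K"
  shows "curve_length g \<le> ennreal K"
  unfolding curve_length_def
proof (rule SUP_least)
  fix ts :: "real list" assume "ts \<in> {ts. sorted ts \<and> set ts \<subseteq> {0..1}}"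
  then have ts: "sorted ts" "\<And>i. i < length ts \<Longrightarrow> ts ! i \<in> {0..1}"
    by (blast, metis (no_types, lifting) mem_Collect_eq nth_mem subsetD)
  define c :: "real \<Rightarrow> real \<Rightarrow> real" where "c = (\<lambda>\<epsilon> t. max \<epsilon> (min (1 - \<epsilon>) t))"
  define S where "S = (\<lambda>\<epsilon>. \<Sum>i<length ts - 1. dist (g (c \<epsilon> (ts ! i))) (g (c \<epsilon> (ts ! Suc i))))"
  have "0 \<le> K" using K[of "1/2" "1/2"] by simp
  have c_mono: "c \<epsilon> s \<le> c \<epsilon> t" if "s \<le> t" for \<epsilon> s t using that by (auto simp: c_def)
  have c_in: "0 < c \<epsilon> t" "c \<epsilon> t < 1" if "0 < \<epsilon>" "\<epsilon> < 1/2" for \<epsilon> t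
    using that by (auto simp: c_def)
  have SK: "S \<epsilon> \<le> K" if \<epsilon>: "0 < \<epsilon>" "\<epsilon> < 1/2" for \<epsilon>
  proof -
    have "S \<epsilon> \<le> (\<Sum>i<length ts - 1. m (c \<epsilon> (ts ! Suc i)) - m (c \<epsilon> (ts ! i)))"
      unfolding S_def
    proof (rule sum_mono)
      fix i assume "i \<in> {..<length ts - 1}"
      then have "ts ! i \<le> ts ! Suc i" using ts(1) by (simp add: sorted_iff_nth_Suc)
      then show "dist (g (c \<epsilon> (ts ! i))) (g (c \<epsilon> (ts ! Suc i))) \<le> m (c \<epsilon> (ts ! Suc i)) - m (c \<epsilon> (ts ! i))"
        by (intro m c_mono c_in \<epsilon>)
    qed
    also have "\<dots> = m (c \<epsilon> (ts ! (length ts - 1))) - m (c \<epsilon> (ts ! 0))"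
      by (rule sum_lessThan_telescope)
    also have "\<dots> \<le> K"
    proof (cases "ts = []")
      case False
      then have "ts ! 0 \<le> ts ! (length ts - 1)" using ts(1) by (intro sorted_nth_mono) auto
      then show ?thesis by (intro K c_mono c_in \<epsilon>)
    qed (use \<open>0 \<le> K\<close> in simp)
    finally show ?thesis .
  qed
  have lim: "((\<lambda>\<epsilon>. g (c \<epsilon> t)) \<longlongrightarrow> g t) (at_right 0)" if t: "t \<in> {0..1}" for t
  proof (rule continuous_on_tendsto_compose[OF g _ t])
    have "((\<lambda>\<epsilon>. c \<epsilon> t) \<longlongrightarrow> max 0 (min (1 - 0) t)) (at_right 0)"
      unfolding c_def by (intro tendsto_intros)
    then show "((\<lambda>\<epsilon>. c \<epsilon> t) \<longlongrightarrow> t) (at_right 0)" using t by simp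
    have "\<forall>\<^sub>F \<epsilon> in at_right 0. \<epsilon> \<in> {0<..<1/2::real}" by (rule eventually_at_right_real) simp
    then show "\<forall>\<^sub>F \<epsilon> in at_right 0. c \<epsilon> t \<in> {0..1}"
      by eventually_elim (use c_in in \<open>simp add: less_imp_le\<close>)
  qed
  have "(S \<longlongrightarrow> (\<Sum>i<length ts - 1. dist (g (ts ! i)) (g (ts ! Suc i)))) (at_right 0)"
    unfolding S_def by (intro tendsto_sum tendsto_dist lim ts) auto
  moreover have "\<forall>\<^sub>F \<epsilon> in at_right 0. S \<epsilon> \<le> K"
    using eventually_at_right_real[of 0 "1/2"] by (auto elim!: eventually_mono intro: SK)
  ultimately have "(\<Sum>i<length ts - 1. dist (g (ts ! i)) (g (ts ! Suc i))) \<le> K"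
    by (rule tendsto_upperbound) simp
  then show "(\<Sum>i<length ts - 1. ennreal (dist (g (ts ! i)) (g (ts ! Suc i)))) \<le> ennreal K"
    by (simp add: sum_ennreal ennreal_leI)
qed

lemma reparam_tendsto_at_top:
  fixes g :: "real \<Rightarrow> 'a::metric_space" and x :: "real \<Rightarrow> real"
  assumes g: "continuous_on {0..1} g" and x: "strict_mono_on {0<..<1} x" "x ` {0<..<1} = UNIV"
    and c: "\<And>t. 0 < t \<Longrightarrow> t < 1 \<Longrightarrow> g t = c (x t)"
  shows "(c \<longlongrightarrow> g 1) at_top"
proof (rule tendstoI)
  fix e :: real assume "0 < e"
  then obtain d where d: "d > 0" "\<And>t. t \<in> {0..1} \<Longrightarrow> dist t 1 < d \<Longrightarrow> dist (g t) (g 1) < e"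
    using g unfolding continuous_on_iff by (metis atLeastAtMost_iff order_refl zero_le_one)
  define t0 where "t0 = max (1/2) (1 - d/2)"
  have t0: "0 < t0" "t0 < 1" "1 - d < t0" using d(1) by (auto simp: t0_def less_max_iff_disj)
  show "\<forall>\<^sub>F y in at_top. dist (c y) (g 1) < e"
    using eventually_gt_at_top[of "x t0"]
  proof eventually_elim
    case (elim y)
    obtain t where t: "0 < t" "t < 1" "y = x t" using x(2) by (metis UNIV_I greaterThanLessThan_iff imageE)
    have "t0 < t"
    proof (rule ccontr)
      assume "\<not> t0 < t"
      then have "x t \<le> x t0" using t t0 strict_mono_onD[OF x(1), of t t0] by (cases "t = t0") auto
      then show False using elim t(3) by simp
    qed
    then have "dist t 1 < d" using t t0 by (simp add: dist_real_def)
    then show ?case using d(2)[of t] t c[of t] by simp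
  qed
qed

text \<open>
  The previous lemma for the parameter run backwards in both source and target.
\<close>
lemma reparam_tendsto_at_bot:
  fixes g :: "real \<Rightarrow> 'a::metric_space" and x :: "real \<Rightarrow> real"
  assumes g: "continuous_on {0..1} g" and x: "strict_mono_on {0<..<1} x" "x ` {0<..<1} = UNIV"
    and c: "\<And>t. 0 < t \<Longrightarrow> t < 1 \<Longrightarrow> g t = c (x t)"
  shows "(c \<longlongrightarrow> g 0) at_bot"
proof -
  have "((\<lambda>y. c (- y)) \<longlongrightarrow> (\<lambda>t. g (1 - t)) 1) at_top"
  proof (rule reparam_tendsto_at_top[of "\<lambda>t. g (1 - t)" "\<lambda>t. - x (1 - t)" "\<lambda>y. c (- y)"])
    show "continuous_on {0..1} (\<lambda>t. g (1 - t))"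
      by (rule continuous_on_compose2[OF g]) (auto intro!: continuous_intros)
    show "strict_mono_on {0<..<1} (\<lambda>t. - x (1 - t))"
      by (rule strict_mono_onI) (auto intro: strict_mono_onD[OF x(1)])
    show "(\<lambda>t. - x (1 - t)) ` {0<..<1} = UNIV"
    proof (intro set_eqI iffI UNIV_I)
      fix y :: real
      obtain t where "t \<in> {0<..<1}" "x t = - y" using x(2) by (metis UNIV_I imageE)
      then show "y \<in> (\<lambda>t. - x (1 - t)) ` {0<..<1}" by (intro image_eqI[of _ _ "1 - t"]) auto
    qed
  qed (use c in simp)
  then show ?thesis unfolding filterlim_at_bot_mirror by simp
qed

text \<open>
  The orientation of \<open>g\<close> relative to the new parameter stays open: the estimates below are
  symmetric in the two ends.
\<close>
lemma reparam_tendsto_ends: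
  fixes g :: "real \<Rightarrow> 'a::metric_space" and x :: "real \<Rightarrow> real"
  assumes g: "continuous_on {0..1} g"
    and x: "strict_mono_on {0<..<1} x \<or> strict_antimono_on {0<..<1} x" "x ` {0<..<1} = UNIV"
    and c: "\<And>t. 0 < t \<Longrightarrow> t < 1 \<Longrightarrow> g t = c (x t)"
  obtains p q where "(c \<longlongrightarrow> p) at_top" "(c \<longlongrightarrow> q) at_bot" "{p, q} = {g 0, g 1}"
proof (cases "strict_mono_on {0<..<1} x")
  case True
  from reparam_tendsto_at_top[OF g True x(2) c] reparam_tendsto_at_bot[OF g True x(2) c] that
  show thesis by blast
next
  case False
  then have am: "strict_antimono_on {0<..<1} x" using x(1) by blast
  have g': "continuous_on {0..1} (\<lambda>t. g (1 - t))"
    by (rule continuous_on_compose2[OF g]) (auto intro!: continuous_intros)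
  have x': "strict_mono_on {0<..<1} (\<lambda>t. x (1 - t))"
    by (rule strict_mono_onI) (auto intro: monotone_onD[OF am])
  have s': "(\<lambda>t. x (1 - t)) ` {0<..<1} = UNIV"
  proof (intro set_eqI iffI UNIV_I)
    fix y :: real
    obtain t where "t \<in> {0<..<1}" "x t = y" using x(2) by (metis UNIV_I imageE)
    then show "y \<in> (\<lambda>t. x (1 - t)) ` {0<..<1}" by (intro image_eqI[of _ _ "1 - t"]) auto
  qed
  have c': "g (1 - t) = c (x (1 - t))" if "0 < t" "t < 1" for t using c that by simp
  from reparam_tendsto_at_top[where c=c, OF g' x' s' c'] reparam_tendsto_at_bot[where c=c, OF g' x' s' c']
  have "(c \<longlongrightarrow> g 0) at_top" "(c \<longlongrightarrow> g 1) at_bot" by simp_all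
  then show thesis by (rule that) auto
qed

lemma curve_length_reparam_le:
  fixes g :: "real \<Rightarrow> 'a::metric_space" and x m :: "real \<Rightarrow> real"
  assumes g: "continuous_on {0..1} g"
    and x: "strict_mono_on {0<..<1} x \<or> strict_antimono_on {0<..<1} x"
    and c: "\<And>t. 0 < t \<Longrightarrow> t < 1 \<Longrightarrow> g t = c (x t)"
    and m: "\<And>a b. a \<le> b \<Longrightarrow> dist (c a) (c b) \<le> m b - m a"
    and K: "\<And>a b. a \<le> b \<Longrightarrow> m b - m a \<le> K"
  shows "curve_length g \<le> ennreal K"
proof (cases "strict_mono_on {0<..<1} x")
  case True
  then have x_le: "x s \<le> x t" if "0 < s" "s \<le> t" "t < 1" for s t
    using that strict_mono_onD[OF True, of s t] by (cases "s = t") auto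
  show ?thesis
    by (rule curve_length_le[OF g, of "\<lambda>t. m (x t)"]) (use c m K x_le in auto)
next
  case False
  then have am: "strict_antimono_on {0<..<1} x" using x by blast
  have x_le: "x t \<le> x s" if "0 < s" "s \<le> t" "t < 1" for s t
    using that monotone_onD[OF am, of s t] by (cases "s = t") auto
  show ?thesis
  proof (rule curve_length_le[OF g, of "\<lambda>t. - m (x t)"])
    fix s t :: real assume st: "0 < s" "s \<le> t" "t < 1"
    show "dist (g s) (g t) \<le> - m (x t) - - m (x s)"
      using m[OF x_le[OF st]] c[of s] c[of t] st by (simp add: dist_commute)
    show "- m (x t) - - m (x s) \<le> K" using K[OF x_le[OF st]] by simp
  qed
qed

section \<open>The image of the imaginary axis\<close>

lemma imaginary_axis_vector_derivative:
  assumes Q: "Q holomorphic_on upper_half_plane"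
  shows "((\<lambda>x. Q (\<i> * of_real (exp x))) has_vector_derivative
           \<i> * of_real (exp x) * deriv Q (\<i> * of_real (exp x))) (at x)"
proof -
  have "((\<lambda>x. \<i> * complex_of_real (exp x)) has_vector_derivative \<i> * of_real (exp x)) (at x)"
    unfolding has_vector_derivative_complex_iff by (auto intro!: derivative_eq_intros)
  moreover have "(Q has_field_derivative deriv Q (\<i> * of_real (exp x))) (at (\<i> * of_real (exp x)))"
    by (rule holomorphic_derivI[OF Q open_upper_half_plane]) (simp add: upper_half_plane_def)
  ultimately show ?thesis
    using field_vector_diff_chain_at by (fastforce simp: o_def)
qed

text \<open>
  The left-hand side of the hypothesis is the speed of \<open>x \<mapsto> Q (\<i> * exp x)\<close>.
\<close>
lemma imaginary_axis_dist_le: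
  fixes V :: "real \<Rightarrow> real"
  assumes Q: "Q holomorphic_on upper_half_plane"
    and V: "\<And>x. (V has_real_derivative V' x) (at x)"
    and le: "\<And>x. a \<le> x \<Longrightarrow> x \<le> b \<Longrightarrow> cmod (deriv Q (\<i> * of_real (exp x))) * exp x \<le> V' x" and ab: "a \<le> b"
  shows "dist (Q (\<i> * of_real (exp a))) (Q (\<i> * of_real (exp b))) \<le> V b - V a"
proof (cases "a = b")
  case False
  let ?c = "\<lambda>x. Q (\<i> * of_real (exp x))"
  note d = imaginary_axis_vector_derivative[OF Q]
  have "norm (?c b - ?c a) \<le> V b - V a"
  proof (rule differentiable_bound_general)
    show "a < b" using False ab by simp
    show "continuous_on {a..b} ?c"
      by (intro continuous_at_imp_continuous_on ballI has_vector_derivative_continuous[OF d])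
    show "continuous_on {a..b} V"
      by (intro continuous_at_imp_continuous_on ballI DERIV_isCont[OF V])
    show "(?c has_vector_derivative \<i> * of_real (exp x) * deriv Q (\<i> * of_real (exp x))) (at x)" for x
      by (rule d)
    show "(V has_vector_derivative V' x) (at x)" for x
      using V by (simp add: has_real_derivative_iff_has_vector_derivative)
    show "norm (\<i> * of_real (exp x) * deriv Q (\<i> * of_real (exp x))) \<le> V' x" if "a < x" "x < b" for x
      using le[of x] that by (simp add: norm_mult mult.commute)
  qed
  then show ?thesis by (simp add: dist_norm norm_minus_commute)
qed simp

text \<open>
  Equality in Schwarz-Pick makes \<open>Q\<close> a Moebius map, so that \<open>cayley P (Q z)\<close> is \<open>\<alpha>\<close> times
  \<open>cayley a z\<close>, where \<open>P = Q a\<close>. The second factor tends to 1 and -1 at the two ends of the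
  imaginary axis, so \<open>cayley P\<close> takes opposite values at the boundary points 1 and -1. Clearing
  denominators, this says \<open>P * cnj P = 1\<close>.
\<close>
lemma Schwarz_Pick_extremal_unit_circle:
  fixes p q :: real
  assumes Q: "Q holomorphic_on upper_half_plane" "Q ` upper_half_plane \<subseteq> upper_half_plane"
    and p: "((\<lambda>x. Q (\<i> * of_real (exp x))) \<longlongrightarrow> of_real p) at_top"
    and q: "((\<lambda>x. Q (\<i> * of_real (exp x))) \<longlongrightarrow> of_real q) at_bot"
    and pq: "q = - p" "p\<^sup>2 = 1"
    and eq: "cmod (deriv Q (\<i> * of_real (exp x0))) * exp x0 = Im (Q (\<i> * of_real (exp x0)))"
  shows "cmod (Q (\<i> * of_real (exp x0))) = 1"
proof -
  let ?H = upper_half_plane and ?a = "\<i> * complex_of_real (exp x0)"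
  have aH: "\<i> * complex_of_real (exp x) \<in> ?H" for x by (simp add: upper_half_plane_def)
  define P where "P = Q ?a"
  have PH: "P \<in> ?H" using aH Q(2) by (auto simp: P_def)
  obtain \<alpha> where \<alpha>: "\<And>z. z \<in> ?H \<Longrightarrow> cayley P (Q z) = \<alpha> * cayley ?a z"
    using Schwarz_Pick_half_plane(3)[OF Q aH[of x0]] eq unfolding P_def by auto
  have cay: "cayley ?a (\<i> * of_real (exp x)) = of_real ((exp x - exp x0) / (exp x + exp x0))" for x
  proof -
    have "cayley ?a (\<i> * of_real (exp x)) = (\<i> * of_real (exp x - exp x0)) / (\<i> * of_real (exp x + exp x0))"
      by (simp add: cayley_def algebra_simps)
    then show ?thesis by simp
  qed
  have nz: "of_real r - cnj P \<noteq> 0" for r :: real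
    using PH by (auto simp: upper_half_plane_def complex_eq_iff)
  have lim: "((\<lambda>x. cayley P (Q (\<i> * of_real (exp x)))) \<longlongrightarrow> (of_real r - P) / (of_real r - cnj P)) F"
    if "((\<lambda>x. Q (\<i> * of_real (exp x))) \<longlongrightarrow> of_real r) F" for r F
    unfolding cayley_def by (intro tendsto_intros that nz)
  have top: "((\<lambda>x. (exp x - exp x0) / (exp x + exp x0)) \<longlongrightarrow> 1) at_top"
  proof -
    have "((\<lambda>x::real. exp (- x)) \<longlongrightarrow> 0) at_top"
      by (rule filterlim_compose[OF exp_at_bot filterlim_uminus_at_bot_at_top])
    then have "((\<lambda>x. (1 - exp x0 * exp (- x)) / (1 + exp x0 * exp (- x))) \<longlongrightarrow> (1 - exp x0 * 0) / (1 + exp x0 * 0)) at_top"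
      by (intro tendsto_intros) auto
    moreover have "(1 - exp x0 * exp (- x)) / (1 + exp x0 * exp (- x)) = (exp x - exp x0) / (exp x + exp x0)" for x
    proof -
      have "(exp x - exp x0) / (exp x + exp x0) = (exp x * (1 - exp x0 * exp (- x))) / (exp x * (1 + exp x0 * exp (- x)))"
        by (simp add: algebra_simps exp_minus_inverse flip: exp_add)
      then show ?thesis by simp
    qed
    ultimately show ?thesis by simp
  qed
  have bot: "((\<lambda>x. (exp x - exp x0) / (exp x + exp x0)) \<longlongrightarrow> -1) at_bot"
  proof -
    have "((\<lambda>x. (exp x - exp x0) / (exp x + exp x0)) \<longlongrightarrow> (0 - exp x0) / (0 + exp x0)) at_bot"
      by (intro tendsto_intros exp_at_bot) auto
    then show ?thesis by simp
  qed
  have cQ: "cayley P (Q (\<i> * of_real (exp x))) = \<alpha> * of_real ((exp x - exp x0) / (exp x + exp x0))" for x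
    using \<alpha>[OF aH] cay by simp
  have "((\<lambda>x. cayley P (Q (\<i> * of_real (exp x)))) \<longlongrightarrow> \<alpha> * of_real 1) at_top"
    unfolding cQ by (intro tendsto_intros top)
  with lim[OF p] have e1: "(of_real p - P) / (of_real p - cnj P) = \<alpha>"
    using tendsto_unique trivial_limit_at_top_linorder by fastforce
  have "((\<lambda>x. cayley P (Q (\<i> * of_real (exp x)))) \<longlongrightarrow> \<alpha> * of_real (-1)) at_bot"
    unfolding cQ by (intro tendsto_intros bot)
  with lim[OF q] have e2: "(of_real q - P) / (of_real q - cnj P) = - \<alpha>"
    using tendsto_unique trivial_limit_at_bot_linorder by fastforce
  have e: "of_real p - P = \<alpha> * (of_real p - cnj P)" "of_real q - P = - \<alpha> * (of_real q - cnj P)"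
    using e1 e2 nz[of p] nz[of q] by (simp_all only: nonzero_divide_eq_eq not_False_eq_True)
  have "(of_real p - P) * (of_real q - cnj P) + (of_real q - P) * (of_real p - cnj P) = 0"
    unfolding e by (simp add: algebra_simps)
  then have "P * cnj P = of_real p * of_real p"
    unfolding pq(1) by (simp add: algebra_simps)
  then have "P * cnj P = 1"
    using pq(2) by (simp only: power2_eq_square of_real_1 flip: of_real_mult)
  then have "of_real ((cmod P)\<^sup>2) = (1 :: complex)" by (simp only: complex_norm_square)
  then have "(cmod P)\<^sup>2 = 1" using of_real_eq_1_iff by blast
  then show ?thesis using norm_ge_zero[of P] unfolding P_def power2_eq_1_iff by linarith
qed

text \<open>
  If the curve is slower than \<open>V'\<close> at one point, it is slower by a fixed \<open>\<delta>\<close> on an interval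
  of length \<open>\<eta>\<close>, and the bound improves by \<open>\<delta> * \<eta>\<close>. The new comparison function subtracts
  \<open>\<delta>\<close> times the parameter clamped to that interval. Since it is not differentiable at the
  two ends, the estimate is proved on three pieces and joined by the triangle inequality.
\<close>
lemma imaginary_axis_dist_le_strict:
  fixes V :: "real \<Rightarrow> real"
  assumes Q: "Q holomorphic_on upper_half_plane"
    and V: "\<And>x. (V has_real_derivative V' x) (at x)" "continuous_on UNIV V'"
    and le: "\<And>x. cmod (deriv Q (\<i> * of_real (exp x))) * exp x \<le> V' x"
    and less: "cmod (deriv Q (\<i> * of_real (exp x0))) * exp x0 < V' x0"
    and K: "\<And>a b. a \<le> b \<Longrightarrow> V b - V a \<le> K"
  obtains m K' where "K' < K"
    "\<And>a b. a \<le> b \<Longrightarrow> dist (Q (\<i> * of_real (exp a))) (Q (\<i> * of_real (exp b))) \<le> m b - m a"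
    "\<And>a b. a \<le> b \<Longrightarrow> m b - m a \<le> K'"
proof -
  let ?c = "\<lambda>x. Q (\<i> * of_real (exp x))"
  define D where "D = (\<lambda>x. V' x - cmod (deriv Q (\<i> * of_real (exp x))) * exp x)"
  have "continuous_on UNIV (\<lambda>x. deriv Q (\<i> * of_real (exp x)))"
    by (rule continuous_on_compose2[OF holomorphic_on_imp_continuous_on[OF holomorphic_deriv[OF Q open_upper_half_plane]]])
       (auto intro!: continuous_intros simp: upper_half_plane_def)
  then have "continuous_on UNIV D" unfolding D_def by (intro continuous_intros V)
  moreover define \<delta> where "\<delta> = D x0 / 2"
  have \<delta>: "\<delta> > 0" using less by (simp add: \<delta>_def D_def)
  ultimately obtain d where d: "d > 0" "\<And>x. dist x x0 < d \<Longrightarrow> dist (D x) (D x0) < \<delta>"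
    unfolding continuous_on_iff by (metis UNIV_I)
  define \<eta> where "\<eta> = d / 2"
  have \<eta>: "\<eta> > 0" using d by (simp add: \<eta>_def)
  have gap: "cmod (deriv Q (\<i> * of_real (exp x))) * exp x \<le> V' x - \<delta>" if "x0 \<le> x" "x \<le> x0 + \<eta>" for x
  proof -
    have "dist x x0 < d" using that d(1) by (simp add: dist_real_def \<eta>_def)
    then have "\<bar>D x - D x0\<bar> < \<delta>" using d(2) by (simp add: dist_real_def)
    then have "\<delta> \<le> D x" unfolding \<delta>_def by linarith
    then show ?thesis unfolding D_def by linarith
  qed
  define k where "k = (\<lambda>x. max x0 (min (x0 + \<eta>) x))"
  define m where "m = (\<lambda>x. V x - \<delta> * k x)"
  have base: "dist (?c a) (?c b) \<le> V b - V a" if "a \<le> b" for a b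
    by (rule imaginary_axis_dist_le[OF Q V(1) le that])
  have mid: "dist (?c a) (?c b) \<le> m b - m a" if "x0 \<le> a" "a \<le> b" "b \<le> x0 + \<eta>" for a b
  proof -
    have "dist (?c a) (?c b) \<le> (V b - \<delta> * b) - (V a - \<delta> * a)"
      by (rule imaginary_axis_dist_le[OF Q, where V' = "\<lambda>x. V' x - \<delta>"])
         (use that gap in \<open>auto intro!: derivative_eq_intros V(1)\<close>)
    then show ?thesis using that by (simp add: m_def k_def)
  qed
  have left: "dist (?c a) (?c b) \<le> m b - m a" if "a \<le> b" "b \<le> x0" for a b
    using base[OF that(1)] that \<eta> by (simp add: m_def k_def)
  have right: "dist (?c a) (?c b) \<le> m b - m a" if "a \<le> b" "x0 + \<eta> \<le> a" for a b
    using base[OF that(1)] that \<eta> by (simp add: m_def k_def)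
  have glue: "dist (?c a) (?c b) \<le> m b - m a"
    if "a \<le> y" "y \<le> b" "dist (?c a) (?c y) \<le> m y - m a" "dist (?c y) (?c b) \<le> m b - m y" for a b y
    using dist_triangle[of "?c a" "?c b" "?c y"] that by linarith
  have lower: "dist (?c a) (?c b) \<le> m b - m a" if "a \<le> b" "b \<le> x0 + \<eta>" for a b
    using left[of a b] mid[of a b] glue[of a x0 b] left[of a x0] mid[of x0 b] that by linarith
  have dm: "dist (?c a) (?c b) \<le> m b - m a" if "a \<le> b" for a b
    using lower[of a b] right[of a b] glue[of a "x0 + \<eta>" b] lower[of a "x0 + \<eta>"] right[of "x0 + \<eta>" b] that by linarith
  have "m b - m a \<le> K - \<delta> * \<eta>" if ab: "a \<le> b" for a b
  proof -
    define a' b' where "a' = min a x0" and "b' = max b (x0 + \<eta>)"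
    have ab': "a' \<le> a" "b \<le> b'" "a' \<le> b'" "a' \<le> x0" "x0 + \<eta> \<le> b'"
      using ab \<eta> by (auto simp: a'_def b'_def)
    have "m a' \<le> m a" "m b \<le> m b'"
      using dm[OF ab'(1)] dm[OF ab'(2)] zero_le_dist[of "?c a'" "?c a"] zero_le_dist[of "?c b" "?c b'"] by linarith+
    then have "m b - m a \<le> m b' - m a'" by linarith
    also have "\<dots> = V b' - V a' - \<delta> * \<eta>"
      using ab' \<eta> by (simp add: m_def k_def algebra_simps)
    finally show ?thesis using K[OF ab'(3)] by linarith
  qed
  then show thesis using dm \<delta> \<eta> by (intro that[of "K - \<delta> * \<eta>" m]) auto
qed

lemma real_analytic_on_holomorphic:
  assumes "G holomorphic_on S" "open S" "\<And>t. t \<in> T \<Longrightarrow> of_real t \<in> S"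
  shows "(\<lambda>t. G (complex_of_real t)) real_analytic_on T"
  unfolding real_analytic_on_def
proof
  fix t assume "t \<in> T"
  then obtain r where r: "r > 0" "ball (complex_of_real t) r \<subseteq> S"
    using assms open_contains_ball by blast
  show "\<exists>r>0. \<exists>a. \<forall>s. \<bar>s - t\<bar> < r \<longrightarrow> (\<lambda>n. (s - t) ^ n *\<^sub>R a n) sums G (complex_of_real s)"
  proof (intro exI[of _ r] conjI r exI[of _ "\<lambda>n. (deriv ^^ n) G (of_real t) / fact n"] allI impI)
    fix s assume s: "\<bar>s - t\<bar> < r"
    then have "complex_of_real s \<in> ball (of_real t) r"
      by (simp add: dist_real_def abs_minus_commute)
    from holomorphic_power_series[OF holomorphic_on_subset[OF assms(1) r(2)] this]
    show "(\<lambda>n. (s - t) ^ n *\<^sub>R ((deriv ^^ n) G (of_real t) / fact n)) sums G (of_real s)"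
      by (simp add: scaleR_conv_of_real mult.commute)
  qed
qed

lemma real_analytic_curve_holomorphic_image:
  assumes G: "G holomorphic_on S" "open S" "inj_on G S" and S: "\<And>t. t \<in> {0<..<1} \<Longrightarrow> of_real t \<in> S"
  shows "real_analytic_curve ((\<lambda>t. G (complex_of_real t)) ` {0<..<1})"
  unfolding real_analytic_curve_def
proof (intro exI conjI ballI)
  show "(\<lambda>t. G (complex_of_real t)) real_analytic_on {0<..<1}"
    by (rule real_analytic_on_holomorphic[OF G(1,2) S])
  show "inj_on (\<lambda>t. G (complex_of_real t)) {0<..<1}"
    using G(3) S unfolding inj_on_def by (metis of_real_eq_iff)
  fix t :: real assume t: "t \<in> {0<..<1}"
  have "(G has_field_derivative deriv G (of_real t)) (at (of_real t))"
    using G S[OF t] by (simp add: holomorphic_derivI)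
  moreover have "(complex_of_real has_vector_derivative 1) (at t)"
    by (auto intro!: derivative_eq_intros)
  ultimately have "((G \<circ> complex_of_real) has_vector_derivative 1 * deriv G (of_real t)) (at t)"
    by (intro field_vector_diff_chain_at)
  then have "vector_derivative (\<lambda>t. G (of_real t)) (at t) = deriv G (of_real t)"
    by (simp add: o_def vector_derivative_at)
  then show "vector_derivative (\<lambda>t. G (of_real t)) (at t) \<noteq> 0"
    using holomorphic_injective_imp_regular[OF G S[OF t]] by simp
qed simp

section \<open>The semicircle\<close>

lemma dist_cis: "dist (cis a) (cis b) = 2 * \<bar>sin ((a - b) / 2)\<bar>"
proof -
  have "(dist (cis a) (cis b))\<^sup>2 = ((cos a)\<^sup>2 + (sin a)\<^sup>2) + ((cos b)\<^sup>2 + (sin b)\<^sup>2) - 2 * (cos a * cos b + sin a * sin b)"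
    unfolding dist_norm cmod_power2 by (simp add: power2_eq_square algebra_simps)
  also have "\<dots> = 2 - 2 * cos (a - b)" by (simp add: cos_diff)
  also have "\<dots> = 2 - 2 * cos (2 * ((a - b) / 2))" by (simp only: nonzero_mult_div_cancel_left times_divide_eq_right)
  also have "\<dots> = (2 * \<bar>sin ((a - b) / 2)\<bar>)\<^sup>2"
    unfolding cos_double_sin by (simp add: power_mult_distrib)
  finally show ?thesis by (rule power2_eq_imp_eq) auto
qed

text \<open>
  On the semicircle the angle \<open>arccos (Re (g t))\<close> is an injective continuous function of the
  parameter, hence monotone, so the regular polygons with \<open>n\<close> sides are inscribed in \<open>g\<close>. Their
  lengths \<open>2 * n * sin (pi / (2 * n))\<close> tend to \<open>pi\<close>.
\<close>
lemma curve_length_semicircle_ge: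
  fixes g :: "real \<Rightarrow> complex"
  assumes g: "arc g" "{pathstart g, pathfinish g} = {-1, 1}"
    and \<gamma>: "open_arc g = sphere 0 1 \<inter> upper_half_plane"
  shows "ennreal pi \<le> curve_length g"
proof -
  have gc: "continuous_on {0..1} g" and ginj: "inj_on g {0..1}"
    using g(1) by (auto simp: arc_def path_def)
  have ends: "g 0 = -1 \<and> g 1 = 1 \<or> g 0 = 1 \<and> g 1 = -1"
    using g(2) by (auto simp: pathstart_def pathfinish_def doubleton_eq_iff)
  have gS: "cmod (g t) = 1 \<and> 0 \<le> Im (g t)" if "t \<in> {0..1}" for t
  proof (cases "t = 0 \<or> t = 1")
    case False
    then have "g t \<in> open_arc g" using that by (auto simp: open_arc_def)
    then show ?thesis using \<gamma> by (auto simp: upper_half_plane_def)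
  qed (use ends in auto)
  define h where "h = (\<lambda>t. arccos (Re (g t)))"
  have Re1: "-1 \<le> Re (g t)" "Re (g t) \<le> 1" if "t \<in> {0..1}" for t
    using gS[OF that] abs_Re_le_cmod[of "g t"] by auto
  have gh: "g t = cis (h t)" if "t \<in> {0..1}" for t
  proof -
    have "(Re (g t))\<^sup>2 + (Im (g t))\<^sup>2 = 1" using gS[OF that] by (simp add: cmod_power2[symmetric])
    then have "Im (g t) = sqrt (1 - (Re (g t))\<^sup>2)" using gS[OF that] by (simp add: real_sqrt_unique algebra_simps)
    then show ?thesis using Re1[OF that] by (simp add: complex_eq_iff h_def cos_arccos sin_arccos)
  qed
  have hc: "continuous_on {0..1} h" unfolding h_def
    by (intro continuous_on_arccos continuous_intros gc) (use Re1 in auto)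
  have "inj_on h {0..1}" using ginj gh by (metis inj_on_def)
  then have mono: "strict_mono_on {0..1} h \<or> strict_antimono_on {0..1} h"
    using injective_eq_monotone_map[OF is_interval_cc hc] by simp
  have hends: "h 0 = pi \<and> h 1 = 0 \<or> h 0 = 0 \<and> h 1 = pi"
    using ends by (auto simp: h_def)
  have surj: "\<exists>t\<in>{0..1}. h t = \<theta>" if "0 \<le> \<theta>" "\<theta> \<le> pi" for \<theta>
    using hends IVT'[of h 0 \<theta> 1] IVT2'[of h 1 \<theta> 0] hc that by fastforce
  have lower: "ennreal (2 * Suc n * sin (pi / (2 * Suc n))) \<le> curve_length g" for n
  proof -
    let ?N = "Suc n"
    define \<kappa> :: "nat \<Rightarrow> real" where
      "\<kappa> = (\<lambda>k. (if strict_mono_on {0..1} h then real k else real ?N - real k) * (pi / ?N))"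
    have \<kappa>r: "0 \<le> \<kappa> k \<and> \<kappa> k \<le> pi" if "k \<le> ?N" for k
    proof -
      let ?u = "if strict_mono_on {0..1} h then real k else real ?N - real k"
      have "0 \<le> ?u" "?u \<le> real ?N" using that by auto
      then have "0 \<le> ?u * (pi / ?N)" "?u * (pi / ?N) \<le> real ?N * (pi / ?N)"
        by (intro mult_nonneg_nonneg mult_right_mono; simp)+
      then show ?thesis by (simp add: \<kappa>_def)
    qed
    have "\<forall>k\<in>{..?N}. \<exists>t. t \<in> {0..1} \<and> h t = \<kappa> k" using surj \<kappa>r by (metis atMost_iff)
    then obtain \<tau> where \<tau>: "\<And>k. k \<le> ?N \<Longrightarrow> \<tau> k \<in> {0..1}" "\<And>k. k \<le> ?N \<Longrightarrow> h (\<tau> k) = \<kappa> k"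
      unfolding bchoice_iff by auto
    have \<tau>mono: "\<tau> k \<le> \<tau> (Suc k)" if k: "Suc k \<le> ?N" for k
    proof (rule ccontr)
      assume "\<not> \<tau> k \<le> \<tau> (Suc k)"
      then have lt: "\<tau> (Suc k) < \<tau> k" by simp
      have p: "0 < pi / ?N" by simp
      note T = \<tau>(1)[of k] \<tau>(1)[of "Suc k"]
      show False
      proof (cases "strict_mono_on {0..1} h")
        case True
        then have "h (\<tau> (Suc k)) < h (\<tau> k)" using lt T k by (intro strict_mono_onD[OF True]) auto
        then have "\<kappa> (Suc k) < \<kappa> k" using \<tau>(2) k by simp
        then show False using True unfolding \<kappa>_def by (simp only: if_True mult_less_cancel_right_pos[OF p]; simp)
      next
        case False
        then have am: "strict_antimono_on {0..1} h" using mono by blast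
        then have "h (\<tau> k) < h (\<tau> (Suc k))" using lt T k by (intro monotone_onD[OF am]) auto
        then have "\<kappa> k < \<kappa> (Suc k)" using \<tau>(2) k by simp
        then show False using False unfolding \<kappa>_def by (simp only: if_False mult_less_cancel_right_pos[OF p]; simp)
      qed
    qed
    define ts where "ts = map \<tau> [0..<Suc ?N]"
    have len: "length ts = Suc ?N" by (simp add: ts_def)
    have nth: "ts ! k = \<tau> k" if "k \<le> ?N" for k
      using that unfolding ts_def by (subst nth_map) (auto simp del: upt_Suc)
    have "sorted ts" unfolding sorted_iff_nth_Suc len using nth \<tau>mono by simp
    moreover have "set ts \<subseteq> {0..1}" using \<tau>(1) by (auto simp: ts_def simp del: upt_Suc)
    ultimately have "(\<Sum>i<length ts - 1. ennreal (dist (g (ts ! i)) (g (ts ! Suc i)))) \<le> curve_length g"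
      unfolding curve_length_def by (intro SUP_upper) simp
    moreover have "dist (g (ts ! i)) (g (ts ! Suc i)) = 2 * sin (pi / (2 * ?N))" if "i < ?N" for i
    proof -
      have "dist (g (ts ! i)) (g (ts ! Suc i)) = dist (cis (\<kappa> i)) (cis (\<kappa> (Suc i)))"
        using that gh \<tau> nth by simp
      also have "\<dots> = 2 * \<bar>sin ((\<kappa> i - \<kappa> (Suc i)) / 2)\<bar>" by (rule dist_cis)
      also have "(\<kappa> i - \<kappa> (Suc i)) / 2 = - (pi / (2 * ?N)) \<or> (\<kappa> i - \<kappa> (Suc i)) / 2 = pi / (2 * ?N)"
        unfolding \<kappa>_def by (simp only: left_diff_distrib[symmetric]) (simp add: divide_simps)
      then have "\<bar>sin ((\<kappa> i - \<kappa> (Suc i)) / 2)\<bar> = \<bar>sin (pi / (2 * ?N))\<bar>" by (metis abs_minus sin_minus)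
      also have "\<dots> = sin (pi / (2 * ?N))"
        by (intro abs_of_nonneg sin_ge_zero) (auto simp: divide_simps)
      finally show ?thesis .
    qed
    ultimately have "(\<Sum>i<?N. ennreal (2 * sin (pi / (2 * ?N)))) \<le> curve_length g"
      by (simp add: len)
    moreover have "0 \<le> sin (pi / (2 * ?N))" by (intro sin_ge_zero) (auto simp: divide_simps)
    then have "(\<Sum>i<?N. ennreal (2 * sin (pi / (2 * ?N)))) = ennreal (\<Sum>i<?N. 2 * sin (pi / (2 * ?N)))"
      by (intro sum_ennreal) simp
    moreover have "(\<Sum>i<?N. 2 * sin (pi / (2 * ?N))) = 2 * ?N * sin (pi / (2 * ?N))"
      by (simp only: sum_constant card_lessThan; simp)
    ultimately show ?thesis by metis
  qed
  have "(\<lambda>n. 2 * Suc n * sin (pi / (2 * Suc n))) \<longlonglongrightarrow> pi"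
  proof -
    let ?h = "\<lambda>n. pi / (2 * Suc n)"
    have "(\<lambda>n. pi / 2 * inverse (real (Suc n))) \<longlonglongrightarrow> pi / 2 * 0"
      by (intro tendsto_mult_left LIMSEQ_inverse_real_of_nat)
    then have "?h \<longlonglongrightarrow> 0" by (simp add: field_simps)
    then have "filterlim ?h (at 0) sequentially" by (simp add: filterlim_at)
    moreover have "((\<lambda>x. sin x / x) \<longlongrightarrow> 1) (at (0::real))"
      using DERIV_sin[of "0::real"] by (simp add: DERIV_def)
    ultimately have "(\<lambda>n. sin (?h n) / ?h n) \<longlonglongrightarrow> 1" by (rule filterlim_compose[rotated])
    then have "(\<lambda>n. pi * (sin (?h n) / ?h n)) \<longlonglongrightarrow> pi * 1" by (rule tendsto_mult_left)
    moreover have "pi * (sin (?h n) / ?h n) = 2 * Suc n * sin (?h n)" for n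
      by (simp add: divide_simps)
    ultimately show ?thesis by (simp add: mult.commute)
  qed
  then have "(\<lambda>n. ennreal (2 * Suc n * sin (pi / (2 * Suc n)))) \<longlonglongrightarrow> ennreal pi"
    by (rule tendsto_ennrealI)
  then show ?thesis by (rule LIMSEQ_le_const2) (use lower in auto)
qed

text \<open>
  An arc from -1 to 1 that stays on the semicircle covers it, by the intermediate value
  theorem for the real part.
\<close>
lemma unit_semicircle_arc:
  fixes g :: "real \<Rightarrow> complex"
  assumes g: "arc g" "{pathstart g, pathfinish g} = {-1, 1}"
    and sub: "open_arc g \<subseteq> sphere 0 1 \<inter> upper_half_plane"
  shows "open_arc g = sphere 0 1 \<inter> upper_half_plane"
proof (intro equalityI sub subsetI)
  fix z :: complex assume z: "z \<in> sphere 0 1 \<inter> upper_half_plane"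
  have gc: "continuous_on {0..1} (\<lambda>t. Re (g t))"
    using g(1) by (intro continuous_intros) (auto simp: arc_def path_def)
  have ends: "g 0 = -1 \<and> g 1 = 1 \<or> g 0 = 1 \<and> g 1 = -1"
    using g(2) by (auto simp: pathstart_def pathfinish_def doubleton_eq_iff)
  have sq: "(Re w)\<^sup>2 + (Im w)\<^sup>2 = 1" "0 < Im w" if "w \<in> sphere 0 1 \<inter> upper_half_plane" for w
    using that by (auto simp: upper_half_plane_def cmod_power2[symmetric])
  have "(Re z)\<^sup>2 < 1" using sq[OF z] zero_less_power2[of "Im z"] by linarith
  then have r: "-1 < Re z" "Re z < 1" using abs_square_less_1[of "Re z"] by auto
  obtain t where t: "t \<in> {0..1}" "Re (g t) = Re z"
    using ends IVT'[of "\<lambda>t. Re (g t)" 0 "Re z" 1] IVT2'[of "\<lambda>t. Re (g t)" 1 "Re z" 0] gc r by fastforce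
  have "t \<noteq> 0" "t \<noteq> 1" using t(2) ends r by auto
  then have gt: "g t \<in> open_arc g" using t(1) by (auto simp: open_arc_def)
  then have gs: "g t \<in> sphere 0 1 \<inter> upper_half_plane" using sub by blast
  have "(Im (g t))\<^sup>2 = (Im z)\<^sup>2" using sq(1)[OF gs] sq(1)[OF z] t(2) by simp
  then have "Im (g t) = Im z" using sq(2)[OF gs] sq(2)[OF z] by simp
  then have "g t = z" using t(2) by (simp add: complex_eq_iff)
  with gt show "z \<in> open_arc g" by simp
qed

section \<open>Arcs with a conformal reflection\<close>

lemma inside_subset_upper_half_plane:
  assumes J: "S \<subseteq> {z. 0 \<le> Im z}" and op: "open (inside S)"
  shows "inside S \<subseteq> upper_half_plane"
proof
  fix z assume z: "z \<in> inside S"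
  have "- {z. 0 \<le> Im z} \<subseteq> outside S"
    by (rule outside_subset_convex[OF _ J]) (use convex_halfspace_Im_ge[of 0] in simp)
  then have le: "inside S \<subseteq> {z. 0 \<le> Im z}"
    using inside_Int_outside[of S] by blast
  obtain e where e: "e > 0" "ball z e \<subseteq> inside S" using op z open_contains_ball by blast
  have "z - \<i> * of_real (e/2) \<in> ball z e" using e(1) by (simp add: dist_norm norm_mult)
  then have "0 \<le> Im (z - \<i> * of_real (e/2))" using e(2) le by blast
  then show "z \<in> upper_half_plane" using e(1) by (simp add: upper_half_plane_def)
qed

theorem proposition2:
  fixes g :: "real \<Rightarrow> complex" and f :: "complex \<Rightarrow> complex" and \<gamma> B :: "complex set"
  assumes "arc g"
    and "{pathstart g, pathfinish g} = {-1, 1}"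
    and "\<gamma> = open_arc g"
    and "\<gamma> \<subseteq> upper_half_plane"
    and "B = inside (\<gamma> \<union> closed_segment (-1) 1)"
    and "conformal_reflection f B \<gamma>"
    and "f ` B \<subseteq> upper_half_plane"
  shows "real_analytic_curve \<gamma> \<and>
         curve_length g \<le> ennreal pi \<and>
         (curve_length g = ennreal pi \<longleftrightarrow> \<gamma> = sphere 0 1 \<inter> upper_half_plane)"
proof -
  let ?H = upper_half_plane
  note g = assms(1,2) and \<gamma> = assms(3) and \<gamma>H = assms(4)
  have gc: "continuous_on {0..1} g" and ginj: "inj_on g {0..1}"
    using g(1) by (auto simp: arc_def path_def)
  have ends: "g 0 = -1 \<and> g 1 = 1 \<or> g 0 = 1 \<and> g 1 = -1"
    using g(2) by (auto simp: pathstart_def pathfinish_def doubleton_eq_iff)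
  have g\<gamma>: "g t \<in> \<gamma>" if "0 < t" "t < 1" for t using that by (auto simp: \<gamma> open_arc_def)
  have con\<gamma>: "connected \<gamma>"
    unfolding \<gamma> open_arc_def by (intro connected_continuous_image continuous_on_subset[OF gc] connected_Ioo) auto

  \<comment> \<open>A parametrisation of the boundary curve whose base point lies off \<open>\<gamma>\<close>.\<close>
  define c where "c = g +++ linepath (pathfinish g) (pathstart g)"
  have pg: "path_image g = \<gamma> \<union> {-1, 1}"
  proof -
    have "{0..1::real} = {0<..<1} \<union> {0, 1}" by auto
    then show ?thesis using ends by (auto simp: path_image_def \<gamma> open_arc_def)
  qed
  have seg: "closed_segment (pathfinish g) (pathstart g) = closed_segment (-1) (1::complex)"
    using ends by (auto simp: pathstart_def pathfinish_def closed_segment_commute)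
  have segR: "Im z = 0" if "z \<in> closed_segment (-1) (1::complex)" for z
    using that by (auto simp: in_segment)
  have imc: "path_image c = \<gamma> \<union> closed_segment (-1) 1"
    unfolding c_def by (subst path_image_join) (auto simp: pg seg)
  have c: "simple_path c" "pathfinish c = pathstart c"
  proof -
    show "pathfinish c = pathstart c" by (simp add: c_def)
    have "path_image g \<inter> closed_segment (-1) 1 \<subseteq> {-1, 1}"
      using segR \<gamma>H by (fastforce simp: pg upper_half_plane_def)
    moreover have "{pathstart g, pathfinish g} = {-1, 1}" by (rule g(2))
    moreover have "pathfinish g \<noteq> pathstart g" using ends by (auto simp: pathstart_def pathfinish_def)
    ultimately show "simple_path c" unfolding c_def
      by (intro simple_path_join_loop g(1) arc_linepath) (auto simp: seg insert_commute)
  qed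
  have B: "B = inside (path_image c)" using assms(5) imc by simp
  note J = Jordan_inside_outside[OF c, folded B]
  have BH: "B \<subseteq> ?H" unfolding B
  proof (rule inside_subset_upper_half_plane)
    show "path_image c \<subseteq> {z. 0 \<le> Im z}"
      using segR \<gamma>H by (fastforce simp: imc upper_half_plane_def)
    show "open (inside (path_image c))" using J B by blast
  qed
  have clB: "closure B = B \<union> path_image c"
    using closure_Un_frontier[of B] J by simp
  have startc: "pathstart c \<notin> \<gamma>"
    using ends \<gamma>H by (auto simp: c_def pathstart_def[of g] upper_half_plane_def)
  have B\<gamma>: "B \<inter> \<gamma> = {}" using imc B by (auto simp: inside_def)

  \<comment> \<open>The fixed points of the involution \<open>F\<close> are exactly the points of \<open>\<gamma>\<close>, so the
    uniformisation maps \<open>\<gamma>\<close> to the imaginary axis.\<close>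
  define F where "F = reflection_extension f B \<gamma>"
  define U where "U = B \<union> \<gamma> \<union> f ` B"
  have refl: "f ` B \<subseteq> - closure B" "inj_on f B" "anti_conformal_automorphism F U"
    using assms(6) by (auto simp: conformal_reflection_def F_def U_def)
  have U: "open U" "connected U" "F anti_holomorphic_on U" "F ` U = U"
    using refl(3) by (auto simp: anti_conformal_automorphism_def domain_def bij_betw_def)
  have UH: "U \<subseteq> ?H" using BH \<gamma>H assms(7) by (auto simp: U_def)
  have cl\<gamma>: "\<gamma> \<subseteq> closure B" using clB imc by auto
  have F_B: "F z = f z" if "z \<in> B" for z using that by (simp add: F_def reflection_extension_def)
  have F_\<gamma>: "F z = z" if "z \<in> \<gamma>" for z
    using that B\<gamma> by (auto simp: F_def reflection_extension_def)
  have F_fB: "F (f z) = z" if "z \<in> B" for z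
  proof -
    have "f z \<notin> closure B" using refl(1) that by blast
    then have "f z \<notin> B" "f z \<notin> \<gamma>" using closure_subset[of B] cl\<gamma> by auto
    then show ?thesis using the_inv_into_f_f[OF refl(2) that] by (simp add: F_def reflection_extension_def)
  qed
  have FF: "F z \<in> U \<and> F (F z) = z" if "z \<in> U" for z
    using that F_B F_\<gamma> F_fB U(4) by (auto simp: U_def)
  have FB: "F ` B = f ` B" by (intro image_cong) (auto simp: F_B)
  have contF: "continuous_on U F"
  proof -
    have "continuous_on U (\<lambda>z. cnj (F z))"
      using U(3) holomorphic_on_imp_continuous_on unfolding anti_holomorphic_on_def by blast
    then have "continuous_on U (\<lambda>z. cnj (cnj (F z)))" by (rule continuous_on_cnj)
    then show ?thesis by simp
  qed
  have scU: "simply_connected U"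
  proof (rule simply_connected_reflected_union[OF c B _ con\<gamma> U(1,2) _ contF FF F_\<gamma>])
    show "\<gamma> \<subseteq> path_image c - {pathstart c}" using imc startc by auto
    show "U = B \<union> \<gamma> \<union> F ` B" by (simp add: FB U_def)
    show "F ` B \<inter> closure B = {}" using refl(1) FB by auto
  qed
  have neU: "U \<noteq> UNIV" using subsetD[OF UH, of 0] by (auto simp: upper_half_plane_def)
  have "g (1/2) \<in> \<gamma>" by (rule g\<gamma>) auto
  then have mid: "g (1/2) \<in> U" "F (g (1/2)) = g (1/2)" using F_\<gamma> by (auto simp: U_def)
  have conB: "connected B" "B \<subseteq> U" using J by (auto simp: U_def)
  have noFix: "F z \<noteq> z" if "z \<in> B" for z
    using that refl(1) closure_subset[of B] F_B[OF that] by force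
  obtain Q R where Q: "Q holomorphic_on ?H" and R: "R holomorphic_on U"
    and QR: "\<And>z. z \<in> ?H \<Longrightarrow> Q z \<in> U \<and> R (Q z) = z"
    and RQ: "\<And>z. z \<in> U \<Longrightarrow> R z \<in> ?H \<and> Q (R z) = z"
    and RF: "\<And>z. z \<in> U \<Longrightarrow> R (F z) = - cnj (R z)"
    and RB: "\<And>z. z \<in> B \<Longrightarrow> 0 < Re (R z)"
    by (rule reflection_uniformization[OF U(1) scU neU U(3) FF mid conB noFix], assumption, assumption) (rule that)
  have QH: "Q ` ?H \<subseteq> ?H" using QR UH by blast
  have \<gamma>U: "\<gamma> \<subseteq> U" by (auto simp: U_def)
  have R\<gamma>: "Re (R z) = 0" if "z \<in> \<gamma>" for z
    using RF[of z] F_\<gamma>[OF that] that \<gamma>U by (auto simp: complex_eq_iff)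
  have RfB: "Re (R z) < 0" if z: "z \<in> f ` B" for z
  proof -
    obtain b where b: "b \<in> B" "z = F b" using z F_B by auto
    then have "R z = - cnj (R b)" using RF[of b] by (simp add: U_def)
    then show ?thesis using RB[OF b(1)] by simp
  qed
  have QB: "Q w \<in> B" if "w \<in> ?H" "0 < Re w" for w
    using QR[OF that(1)] R\<gamma>[of "Q w"] RfB[of "Q w"] that(2) by (auto simp: U_def)
  have iH: "\<i> * complex_of_real (exp x) \<in> ?H" for x by (simp add: upper_half_plane_def)
  have Q\<gamma>: "Q (\<i> * of_real (exp x)) \<in> \<gamma>" for x
    using QR[OF iH[of x]] RB[of "Q (\<i> * of_real (exp x))"] RfB[of "Q (\<i> * of_real (exp x))"] by (auto simp: U_def)

  \<comment> \<open>The hyperbolic arc length parameter of the imaginary axis.\<close>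
  define x where "x = (\<lambda>t. ln (Im (R (g t))))"
  have Rg: "R (g t) = \<i> * of_real (exp (x t))" if "0 < t" "t < 1" for t
    using R\<gamma>[OF g\<gamma>[OF that]] RQ[of "g t"] g\<gamma>[OF that] \<gamma>U
    by (auto simp: x_def complex_eq_iff upper_half_plane_def)
  have gx: "g t = Q (\<i> * of_real (exp (x t)))" if "0 < t" "t < 1" for t
    using RQ[of "g t"] g\<gamma>[OF that] \<gamma>U Rg[OF that] by auto
  have xc: "continuous_on {0<..<1} x"
  proof -
    have "continuous_on {0<..<1} (\<lambda>t. R (g t))"
      by (rule continuous_on_compose2[OF holomorphic_on_imp_continuous_on[OF R] continuous_on_subset[OF gc]])
         (use g\<gamma> \<gamma>U in auto)
    moreover have "0 < Im (R (g t))" if "0 < t" "t < 1" for t using Rg[OF that] by simp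
    ultimately show ?thesis unfolding x_def
      by (intro continuous_on_ln continuous_intros) (auto simp: less_imp_neq[symmetric])
  qed
  have "inj_on x {0<..<1}"
  proof (rule inj_onI)
    fix s t assume "s \<in> {0<..<1}" "t \<in> {0<..<1}" "x s = x t"
    then show "s = t" using gx[of s] gx[of t] inj_onD[OF ginj, of s t] by auto
  qed
  then have xmono: "strict_mono_on {0<..<1} x \<or> strict_antimono_on {0<..<1} x"
    using injective_eq_monotone_map[OF _ xc] is_interval_oo by blast
  have xsurj: "x ` {0<..<1} = UNIV"
  proof (intro set_eqI iffI UNIV_I)
    fix y :: real
    obtain t where t: "0 < t" "t < 1" "g t = Q (\<i> * of_real (exp y))"
      using Q\<gamma>[of y] by (auto simp: \<gamma> open_arc_def)
    then have "x t = y" using QR[OF iH[of y]] by (simp add: x_def)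
    then show "y \<in> x ` {0<..<1}" using t by auto
  qed
  let ?c = "\<lambda>y. Q (\<i> * of_real (exp y))"
  obtain p0 q0 where "(?c \<longlongrightarrow> p0) at_top" "(?c \<longlongrightarrow> q0) at_bot" "{p0, q0} = {g 0, g 1}"
    using reparam_tendsto_ends[OF gc xmono xsurj, of ?c] gx by blast
  then obtain p q :: real where pq: "(?c \<longlongrightarrow> of_real p) at_top" "(?c \<longlongrightarrow> of_real q) at_bot"
    "q = - p" "p\<^sup>2 = 1" "\<bar>p - q\<bar> = 2"
  proof -
    assume *: "(?c \<longlongrightarrow> p0) at_top" "(?c \<longlongrightarrow> q0) at_bot" "{p0, q0} = {g 0, g 1}"
      and "\<And>p q. (?c \<longlongrightarrow> of_real p) at_top \<Longrightarrow> (?c \<longlongrightarrow> of_real q) at_bot \<Longrightarrow>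
        q = - p \<Longrightarrow> p\<^sup>2 = 1 \<Longrightarrow> \<bar>p - q\<bar> = 2 \<Longrightarrow> thesis"
    note th = this(4)
    have "p0 = 1 \<and> q0 = -1 \<or> p0 = -1 \<and> q0 = 1"
      using *(3) ends by (auto simp: doubleton_eq_iff)
    then show thesis using th[of 1 "-1"] th[of "-1" 1] * by auto
  qed

  have bB: "bounded B" by (intro J[THEN conjunct2, THEN conjunct2, THEN conjunct2, THEN conjunct2, THEN conjunct2, THEN conjunct2, THEN conjunct1])
  obtain M where M: "\<And>z. z \<in> B \<Longrightarrow> cmod z \<le> M"
    using bB unfolding bounded_iff by (elim exE) (rule that, blast)
  have bottom: "\<exists>d>0. \<forall>w\<in>?H. 0 < Re w \<and> Im w < d \<longrightarrow> Im (Q w) < e" if e: "0 < e" for e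
  proof -
    \<comment> \<open>A limit of values \<open>Q w\<close>, as \<open>w\<close> approaches the real axis, cannot lie in \<open>U\<close>; but the points
      of the closure of \<open>B\<close> outside \<open>U\<close> are all real. Compactness of \<open>K\<close> makes this uniform.\<close>
    define K where "K = closure B \<inter> {z. e \<le> Im z}"
    have "compact K" unfolding K_def
      by (intro compact_Int_closed closed_halfspace_Im_ge) (simp add: compact_closure bB)
    have "K \<subseteq> U" using segR e by (auto simp: K_def clB imc U_def)
    have cK: "compact ((\<lambda>z. Im (R z)) ` K)"
      by (intro compact_continuous_image \<open>compact K\<close> continuous_intros
            holomorphic_on_imp_continuous_on holomorphic_on_subset[OF R \<open>K \<subseteq> U\<close>])
    have nK: "0 \<notin> (\<lambda>z. Im (R z)) ` K" using RQ \<open>K \<subseteq> U\<close> by (force simp: upper_half_plane_def)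
    obtain d where d: "d > 0" "\<And>y. y \<in> (\<lambda>z. Im (R z)) ` K \<Longrightarrow> d \<le> dist 0 y"
      using separate_point_closed[OF compact_imp_closed[OF cK] nK] by metis
    show ?thesis
    proof (intro exI[of _ d] conjI d ballI impI)
      fix w assume w: "w \<in> ?H" "0 < Re w \<and> Im w < d"
      show "Im (Q w) < e"
      proof (rule ccontr)
        assume "\<not> Im (Q w) < e"
        then have "Q w \<in> K" using QB w closure_subset[of B] by (auto simp: K_def)
        then have "Im (R (Q w)) \<in> (\<lambda>z. Im (R z)) ` K" by blast
        then have "d \<le> dist 0 (Im w)" using d(2) QR[OF w(1)] by auto
        then show False using w by (simp add: upper_half_plane_def)
      qed
    qed
  qed
  obtain V where V: "\<And>y. (V has_real_derivative Im (?c y)) (at y)"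
    and Vpi: "\<And>a b. a \<le> b \<Longrightarrow> V b - V a \<le> pi"
  proof (rule half_plane_height_primitive[OF Q QH, of M p q])
    show "cmod (Q w) \<le> M" if "w \<in> ?H" "0 < Re w" for w using M QB that by blast
    fix V assume "\<And>y. (V has_real_derivative Im (?c y)) (at y)"
      "\<And>a b. a \<le> b \<Longrightarrow> V b - V a \<le> pi / 2 * \<bar>p - q\<bar>"
    then show thesis using pq(5) by (intro that[of V]) auto
  qed (use bottom pq in blast)+
  have SP: "cmod (deriv Q (\<i> * of_real (exp y))) * exp y \<le> Im (?c y)" for y
    using Schwarz_Pick_half_plane(2)[OF Q QH iH[of y]] by simp
  have length: "curve_length g \<le> ennreal pi"
    by (rule curve_length_reparam_le[OF gc xmono, of ?c V])
       (use gx Vpi imaginary_axis_dist_le[OF Q V SP] in auto)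

  have "\<gamma> = sphere 0 1 \<inter> ?H" if len: "curve_length g = ennreal pi"
  proof -
    have eq: "cmod (deriv Q (\<i> * of_real (exp y))) * exp y = Im (?c y)" for y
    proof (rule ccontr)
      assume "cmod (deriv Q (\<i> * of_real (exp y))) * exp y \<noteq> Im (?c y)"
      then have less: "cmod (deriv Q (\<i> * of_real (exp y))) * exp y < Im (?c y)" using SP[of y] by simp
      have contc: "continuous_on UNIV (\<lambda>y. Im (?c y))"
        by (intro continuous_intros continuous_on_compose2[OF holomorphic_on_imp_continuous_on[OF Q]])
           (use iH in auto)
      obtain m K' where m: "K' < pi" "\<And>a b. a \<le> b \<Longrightarrow> dist (?c a) (?c b) \<le> m b - m a"
        "\<And>a b. a \<le> b \<Longrightarrow> m b - m a \<le> K'"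
        by (rule imaginary_axis_dist_le_strict[OF Q V contc SP less Vpi], assumption) (rule that)
      have "curve_length g \<le> ennreal K'"
        by (rule curve_length_reparam_le[OF gc xmono, of ?c m]) (use gx m in auto)
      also have "\<dots> < ennreal pi" using m(1) by (simp add: ennreal_less_iff ennreal_lessI)
      finally show False using len by simp
    qed
    have "cmod (?c y) = 1" for y
      by (rule Schwarz_Pick_extremal_unit_circle[OF Q QH pq(1-4) eq])
    then have "\<gamma> \<subseteq> sphere 0 1 \<inter> ?H"
      using gx \<gamma>H by (auto simp: \<gamma> open_arc_def)
    then show ?thesis using unit_semicircle_arc[OF g] \<gamma> by simp
  qed
  moreover have "curve_length g = ennreal pi" if "\<gamma> = sphere 0 1 \<inter> ?H"
    using curve_length_semicircle_ge[OF g] that length \<gamma> by (auto intro: antisym)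
  moreover have "real_analytic_curve \<gamma>"
  proof -
    \<comment> \<open>On reals \<open>t\<close> this is \<open>Q (\<i> * (t / (1 - t)))\<close>, which runs through the whole axis.\<close>
    define G where "G = (\<lambda>z. Q (inv_cayley \<i> (2 * z - 1)))"
    let ?S = "ball (1/2 :: complex) (1/2)"
    have i: "\<i> \<in> ?H" by (simp add: upper_half_plane_def)
    have S: "2 * z - 1 \<in> ball 0 1" if "z \<in> ?S" for z
    proof -
      have eq: "cmod (2 * z - 1) = 2 * cmod (1/2 - z)"
        using norm_mult[of 2 "1/2 - z"] by (simp add: norm_minus_commute algebra_simps)
      show ?thesis unfolding mem_ball_0 eq using that by (simp add: dist_norm)
    qed
    have "(\<lambda>z. inv_cayley \<i> (2 * z - 1)) holomorphic_on ?S"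
      by (rule holomorphic_on_compose_fun[OF _ holomorphic_inv_cayley S]) (auto intro!: holomorphic_intros)
    then have holG: "G holomorphic_on ?S" unfolding G_def
      by (rule holomorphic_on_compose_fun[OF _ Q inv_cayley_in_half_plane[OF i S]])
    have injG: "inj_on G ?S"
    proof (rule inj_onI)
      fix z w assume z: "z \<in> ?S" and w: "w \<in> ?S" and "G z = G w"
      then have "inv_cayley \<i> (2 * z - 1) = inv_cayley \<i> (2 * w - 1)"
        using QR[OF inv_cayley_in_half_plane[OF i S]] unfolding G_def by metis
      then have "2 * z - 1 = 2 * w - 1"
        using cayley_inv_cayley[OF i S] z w by metis
      then show "z = w" by simp
    qed
    have tS: "complex_of_real t \<in> ?S" if "t \<in> {0<..<1}" for t
    proof -
      have "dist (1/2 :: complex) (of_real t) = \<bar>1/2 - t\<bar>"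
        by (metis dist_of_real dist_real_def of_real_1 of_real_divide of_real_numeral)
      moreover have "\<bar>1/2 - t\<bar> < 1/2" using that unfolding abs_less_iff greaterThanLessThan_iff by linarith
      ultimately show ?thesis by simp
    qed
    have Gt: "G (of_real t) = Q (\<i> * of_real (t / (1 - t)))" if "t \<in> {0<..<1}" for t
    proof -
      have "1 - complex_of_real t \<noteq> 0" using that by (metis greaterThanLessThan_iff less_irrefl of_real_1 of_real_eq_iff right_minus_eq)
      then have "inv_cayley \<i> (2 * of_real t - 1) = \<i> * of_real (t / (1 - t))"
        by (simp add: inv_cayley_def divide_simps) (simp add: algebra_simps)
      then show ?thesis by (simp add: G_def)
    qed
    have "(\<lambda>t. G (of_real t)) ` {0<..<1} = \<gamma>"
    proof (intro equalityI subsetI)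
      fix z assume "z \<in> (\<lambda>t. G (of_real t)) ` {0<..<1}"
      then obtain t where t: "0 < t" "t < 1" "z = Q (\<i> * of_real (t / (1 - t)))" using Gt by auto
      then show "z \<in> \<gamma>" using Q\<gamma>[of "ln (t / (1 - t))"] by (simp add: exp_ln)
    next
      fix z assume "z \<in> \<gamma>"
      then obtain y where y: "z = Q (\<i> * of_real (exp y))" using gx by (auto simp: \<gamma> open_arc_def)
      define t where "t = exp y / (1 + exp y)"
      have "1 + exp y > 0" by (simp add: add_pos_pos)
      then have t: "t \<in> {0<..<1}" "t / (1 - t) = exp y" by (auto simp: t_def divide_simps)
      then show "z \<in> (\<lambda>t. G (of_real t)) ` {0<..<1}" using Gt[OF t(1)] y by (intro image_eqI[of _ _ t]) auto
    qed
    then show ?thesis using real_analytic_curve_holomorphic_image[OF holG open_ball injG tS] by simp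
  qed
  ultimately show ?thesis using length by blast
qed

end
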